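(* Consider the linear regression model $Y_i=\beta_0+\sum_{j=1}^p\beta_jx_{ij}+\varepsilon_i$, $i=1,\dots,n$, with deterministic design, where $\varepsilon_1,\dots,\varepsilon_n$ are i.i.d. $b$-subgaussian random variables with variance $\sigma^2$, and let $p\ge n$. Let $k>1$ be fixed, $K=kp_0$, and assume the consistency condition $$\lim_{n\to\infty}\min\left\{\frac{\Delta(s)}{p_0\ln p}\colon s_0\nsubseteq s,\ k(s)\le K\right\}=\infty .$$ For a constant $\gamma\ge 1$ let $\mathrm{mBIC}_\gamma(s)=n\ln \mathrm{RSS}(s)+k(s)\ln n+2\gamma k(s)\ln p$. We say that $\mathrm{mBIC}_\gamma$ is consistent if $$\mathrm{P}\left(\mathrm{mBIC}_\gamma(s)>\mathrm{mBIC}_\gamma(s_0)\ \text{ for all } s\ne s_0 \text{ with } k(s)\le K\right)\xrightarrow{n\to\infty}1 .$$ Then: (i) if $p_0\ln p=o(n)$ and $\gamma>b^2/\sigma^2$, then $\mathrm{mBIC}_\gamma$ is consistent; (ii) if $\gamma=b^2/\sigma^2$, then $\mathrm{mBIC}_\gamma$ is consistent provided that $\sqrt{\ln p}=o(\ln n)$ and $p_0=O(n^\alpha)$ for some $\alpha<1$; (iii) if $1\le\gamma<b^2/\sigma^2$, then $\mathrm{mBIC}_\gamma$ is consistent provided that $p_0=O(n^\alpha)$ for some $\alpha<1$ and $p=O(n^\delta)$ for some $\delta<\dfrac{1}{2(b^2/\sigma^2-\gamma)}$.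
   Context: Asymptotics are as $n\to\infty$. The number of predictors $p=p_n$, the design $(x_{ij})$, the coefficients $\beta_0,\beta_1,\dots,\beta_p$, the true model and its size $p_0\ge1$ may all depend on $n$; $b$, $\sigma>0$, $\gamma$, $k$ and the law of $\varepsilon_i$ do not. A random variable $\varepsilon$ is $b$-subgaussian ($b>0$) if $\mathrm{E}(e^{t\varepsilon})\le e^{b^2t^2/2}$ for every $t\in\mathbb{R}$. Models are subsets $s\subseteq\{1,\dots,p\}$, and $k(s)$ is the number of elements of $s$. The true model is $s_0=\{j\in\{1,\dots,p\}\colon\beta_j\ne0\}$, and $p_0=k(s_0)$. $X(s)$ is the matrix formed by the columns $(x_{1j},\dots,x_{nj})^T$ of the design with indices $j\in s$, together with the intercept column of ones, which belongs to every model and is not counted in $k(s)$; $\beta(s)$ is the corresponding vector of coefficients. $H(s)$ is the matrix of the orthogonal projection of $\mathbb{R}^n$ onto the span of the columns of $X(s)$. $\mathrm{RSS}(s)=Y^T[I-H(s)]Y$ is the residual sum of squares of model $s$. Further, $\mu=X(s_0)\beta(s_0)$ and $\Delta(s)=\|\mu-H(s)\mu\|^2$ (Euclidean norm). *)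

theory Defs
  imports
    "HOL-Probability.Probability"
    "HOL-Library.Landau_Symbols"
    "Jordan_Normal_Form.VS_Connect"
begin

text \<open>Here \<open>$\<close> and \<open>\<bullet>\<close> are those of the matrices with variable dimension.\<close>

unbundle no vec_syntax
unbundle no inner_syntax

definition subgaussian :: "real \<Rightarrow> 'a measure \<Rightarrow> ('a \<Rightarrow> real) \<Rightarrow> bool" where
  "subgaussian b M X \<longleftrightarrow> b > 0 \<and> X \<in> borel_measurable M \<and>
     (\<forall>t. integrable M (\<lambda>\<omega>. exp (t * X \<omega>)) \<and>
          (\<integral>\<omega>. exp (t * X \<omega>) \<partial>M) \<le> exp (b\<^sup>2 * t\<^sup>2 / 2))"

text \<open>For one sample size \<open>n\<close>, the design is \<open>x :: nat \<Rightarrow> nat \<Rightarrow> real\<close>, where \<open>x i j\<close> is the value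
  of predictor \<open>j \<in> {1..p}\<close> in observation \<open>i \<in> {1..n}\<close>, and \<open>\<beta> :: nat \<Rightarrow> real\<close> carries the intercept
  \<open>\<beta> 0\<close> and the coefficients \<open>\<beta> 1, \<dots>, \<beta> p\<close>. Entries of vectors and matrices of
  the library are numbered from \<open>0\<close>, so observation \<open>i\<close> is stored in row \<open>i - 1\<close>. In the matrix
  of a model, column \<open>0\<close> is the intercept, followed by the predictors of the
  model in increasing order.\<close>

definition true_model :: "nat \<Rightarrow> (nat \<Rightarrow> real) \<Rightarrow> nat set" where
  "true_model p \<beta> = {j \<in> {1..p}. \<beta> j \<noteq> 0}"

definition design_mat :: "nat \<Rightarrow> (nat \<Rightarrow> nat \<Rightarrow> real) \<Rightarrow> nat set \<Rightarrow> real mat" where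
  "design_mat n x s = mat_of_cols n
     (vec n (\<lambda>_. 1) # map (\<lambda>j. vec n (\<lambda>i. x (Suc i) j)) (sorted_list_of_set s))"

definition coef_vec :: "(nat \<Rightarrow> real) \<Rightarrow> nat set \<Rightarrow> real vec" where
  "coef_vec \<beta> s = vec_of_list (\<beta> 0 # map \<beta> (sorted_list_of_set s))"

definition is_orth_proj :: "nat \<Rightarrow> real vec set \<Rightarrow> real mat \<Rightarrow> bool" where
  "is_orth_proj n W H \<longleftrightarrow> H \<in> carrier_mat n n \<and>
     (\<forall>y \<in> carrier_vec n. H *\<^sub>v y \<in> W \<and> (\<forall>w \<in> W. w \<bullet> (y - H *\<^sub>v y) = 0))"

text \<open>The columns of \<open>design_mat n x s\<close> may be linearly dependent, so \<open>X (X\<^sup>T X)\<^sup>-\<^sup>1 X\<^sup>T\<close> is not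
  available; the projection itself always exists and is unique (lemma
  \<open>hat_mat_is_orth_proj\<close> below).\<close>

definition hat_mat :: "nat \<Rightarrow> (nat \<Rightarrow> nat \<Rightarrow> real) \<Rightarrow> nat set \<Rightarrow> real mat" where
  "hat_mat n x s = (THE H. is_orth_proj n (vec_space.col_space n (design_mat n x s)) H)"

definition euclid_norm :: "real vec \<Rightarrow> real" where
  "euclid_norm v = sqrt (v \<bullet> v)"

definition mean_vec :: "nat \<Rightarrow> nat \<Rightarrow> (nat \<Rightarrow> nat \<Rightarrow> real) \<Rightarrow> (nat \<Rightarrow> real) \<Rightarrow> real vec" where
  "mean_vec n p x \<beta> =
     design_mat n x (true_model p \<beta>) *\<^sub>v coef_vec \<beta> (true_model p \<beta>)"

definition Delta :: "nat \<Rightarrow> nat \<Rightarrow> (nat \<Rightarrow> nat \<Rightarrow> real) \<Rightarrow> (nat \<Rightarrow> real) \<Rightarrow> nat set \<Rightarrow> real" where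
  "Delta n p x \<beta> s = (euclid_norm (mean_vec n p x \<beta> - hat_mat n x s *\<^sub>v mean_vec n p x \<beta>))\<^sup>2"

definition response ::
  "nat \<Rightarrow> nat \<Rightarrow> (nat \<Rightarrow> nat \<Rightarrow> real) \<Rightarrow> (nat \<Rightarrow> real) \<Rightarrow> (nat \<Rightarrow> real) \<Rightarrow> real vec" where
  "response n p x \<beta> e =
     vec n (\<lambda>i. \<beta> 0 + (\<Sum>j = 1..p. \<beta> j * x (Suc i) j) + e (Suc i))"

definition RSS :: "nat \<Rightarrow> (nat \<Rightarrow> nat \<Rightarrow> real) \<Rightarrow> real vec \<Rightarrow> nat set \<Rightarrow> real" where
  "RSS n x y s = y \<bullet> ((1\<^sub>m n - hat_mat n x s) *\<^sub>v y)"

text \<open>A model may fit the data perfectly, so the criterion is extended-real-valued with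
  \<open>ln 0 = -\<infinity>\<close>; the library's real logarithm has \<open>ln 0 = 0\<close>. The residual sum of squares is never
  negative.\<close>

definition ext_ln :: "real \<Rightarrow> ereal" where
  "ext_ln r = (if r \<le> 0 then -\<infinity> else ereal (ln r))"

definition mBIC ::
  "real \<Rightarrow> nat \<Rightarrow> nat \<Rightarrow> (nat \<Rightarrow> nat \<Rightarrow> real) \<Rightarrow> real vec \<Rightarrow> nat set \<Rightarrow> ereal" where
  "mBIC \<gamma> n p x y s = ereal (real n) * ext_ln (RSS n x y s)
     + ereal (real (card s) * ln (real n) + 2 * \<gamma> * real (card s) * ln (real p))"

text \<open>In the following two definitions every object is a sequence indexed by the sample size \<open>n\<close>;
  \<open>e n i\<close> is the error of observation \<open>i\<close> at sample size \<open>n\<close>, defined on \<open>M n\<close>.\<close>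

definition consistency_condition ::
  "real \<Rightarrow> (nat \<Rightarrow> nat) \<Rightarrow> (nat \<Rightarrow> nat \<Rightarrow> nat \<Rightarrow> real) \<Rightarrow> (nat \<Rightarrow> nat \<Rightarrow> real) \<Rightarrow> bool" where
  "consistency_condition k p x \<beta> \<longleftrightarrow>
     filterlim (\<lambda>n. let s\<^sub>0 = true_model (p n) (\<beta> n); p\<^sub>0 = card s\<^sub>0 in
         Min {Delta n (p n) (x n) (\<beta> n) s / (real p\<^sub>0 * ln (real (p n))) | s.
              s \<subseteq> {1..p n} \<and> \<not> s\<^sub>0 \<subseteq> s \<and> real (card s) \<le> k * real p\<^sub>0})
       at_top sequentially"

definition mBIC_consistent ::
  "real \<Rightarrow> real \<Rightarrow> (nat \<Rightarrow> nat) \<Rightarrow> (nat \<Rightarrow> nat \<Rightarrow> nat \<Rightarrow> real) \<Rightarrow> (nat \<Rightarrow> nat \<Rightarrow> real) \<Rightarrow>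
   (nat \<Rightarrow> 'a measure) \<Rightarrow> (nat \<Rightarrow> nat \<Rightarrow> 'a \<Rightarrow> real) \<Rightarrow> bool" where
  "mBIC_consistent \<gamma> k p x \<beta> M e \<longleftrightarrow>
     (\<lambda>n. let s\<^sub>0 = true_model (p n) (\<beta> n); p\<^sub>0 = card s\<^sub>0;
             y = (\<lambda>\<omega>. response n (p n) (x n) (\<beta> n) (\<lambda>i. e n i \<omega>)) in
         measure (M n) {\<omega> \<in> space (M n).
           \<forall>s. s \<subseteq> {1..p n} \<and> s \<noteq> s\<^sub>0 \<and> real (card s) \<le> k * real p\<^sub>0 \<longrightarrow>
               mBIC \<gamma> n (p n) (x n) (y \<omega>) s > mBIC \<gamma> n (p n) (x n) (y \<omega>) s\<^sub>0})
       \<longlonglongrightarrow> 1"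


lemma is_orth_proj_unique:
  assumes W: "W \<subseteq> carrier_vec n" and sub: "\<And>u v. u \<in> W \<Longrightarrow> v \<in> W \<Longrightarrow> u - v \<in> W"
    and H: "is_orth_proj n W H" and G: "is_orth_proj n W G"
  shows "H = G"
proof -
  have Hc: "H \<in> carrier_mat n n" and Gc: "G \<in> carrier_mat n n"
    using H G by (auto simp: is_orth_proj_def)
  have eq: "H *\<^sub>v y = G *\<^sub>v y" if y: "y \<in> carrier_vec n" for y
  proof -
    define d where "d = H *\<^sub>v y - G *\<^sub>v y"
    have Hy: "H *\<^sub>v y \<in> carrier_vec n" and Gy: "G *\<^sub>v y \<in> carrier_vec n" using Hc Gc y by auto
    have d: "d \<in> W" "d \<in> carrier_vec n"
      using H G y sub Hy Gy by (auto simp: is_orth_proj_def d_def)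
    have 1: "d \<bullet> (y - H *\<^sub>v y) = 0" "d \<bullet> (y - G *\<^sub>v y) = 0"
      using d H G y by (auto simp: is_orth_proj_def)
    have "d \<bullet> d = d \<bullet> (H *\<^sub>v y) - d \<bullet> (G *\<^sub>v y)"
      unfolding d_def[symmetric] using d Hy Gy
      by (subst (2) d_def) (rule scalar_prod_minus_distrib, auto)
    also have "\<dots> = 0"
      using 1 scalar_prod_minus_distrib[OF d(2) y Hy] scalar_prod_minus_distrib[OF d(2) y Gy] by simp
    finally have "(\<Sum>i = 0..<n. d $ i * d $ i) = 0"
      using d(2) by (auto simp: scalar_prod_def)
    hence "\<forall>i\<in>{0..<n}. d $ i * d $ i = 0"
      by (subst (asm) sum_nonneg_eq_0_iff) auto
    hence di: "d $ i = 0" if "i < n" for i using that by auto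
    show ?thesis
    proof (rule eq_vecI)
      fix i assume "i < dim_vec (G *\<^sub>v y)"
      hence "i < n" using Gc by simp
      with di[OF this] Hc Gc show "(H *\<^sub>v y) $ i = (G *\<^sub>v y) $ i" by (simp add: d_def)
    qed (use Hc Gc in auto)
  qed
  show ?thesis
  proof (rule eq_matI)
    fix i j assume ij: "i < dim_row G" "j < dim_col G"
    hence ij: "i < n" "j < n" using Gc by auto
    have "(H *\<^sub>v unit_vec n j) $ i = (G *\<^sub>v unit_vec n j) $ i" using eq by simp
    thus "H $$ (i, j) = G $$ (i, j)" using ij Hc Gc by simp
  qed (use Hc Gc in auto)
qed

lemma lincomb_orthogonal:
  fixes n :: nat and u :: "real vec"
  assumes S: "S \<subseteq> carrier_vec n" and u: "u \<in> carrier_vec n"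
    and orth: "\<And>v. v \<in> S \<Longrightarrow> v \<bullet> u = 0"
    and w: "w \<in> LinearCombinations.module.span class_ring (module_vec TYPE(real) n) S"
  shows "w \<bullet> u = 0"
proof -
  interpret vec_space "TYPE(real)" n .
  obtain a A where A: "A \<subseteq> S" "finite A" and wa: "w = lincomb a A"
    using w by (auto simp: span_def)
  have car: "(\<lambda>v. a v \<cdot>\<^sub>v v) \<in> A \<rightarrow> carrier_vec n" using A S by auto
  have "w \<bullet> u = (\<Sum>v\<in>A. (a v \<cdot>\<^sub>v v) \<bullet> u)"
    unfolding wa lincomb_def by (rule finsum_scalar_prod_sum[OF car u])
  also have "\<dots> = 0"
  proof (rule sum.neutral, rule ballI)
    fix v assume "v \<in> A"
    hence v: "v \<in> S" "v \<in> carrier_vec n" using A S by auto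
    show "(a v \<cdot>\<^sub>v v) \<bullet> u = 0" using orth[OF v(1)] v(2) u by simp
  qed
  finally show ?thesis .
qed

lemma is_orth_proj_exists:
  fixes n :: nat and vs :: "real vec list"
  assumes "set vs \<subseteq> carrier_vec n"
  shows "\<exists>H. is_orth_proj n (LinearCombinations.module.span class_ring (module_vec TYPE(real) n) (set vs)) H"
proof -
  interpret vec_space "TYPE(real)" n .
  show ?thesis using assms
  proof (induction vs)
    case Nil
    have "0\<^sub>m n n *\<^sub>v y = 0\<^sub>v n" if "y \<in> carrier_vec n" for y :: "real vec"
      using that by auto
    moreover have "span {} = {0\<^sub>v n}" by (rule span_empty)
    ultimately have "is_orth_proj n (span (set [])) (0\<^sub>m n n)"
      unfolding is_orth_proj_def by auto
    thus ?case by blast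
  next
    case (Cons v vs)
    let ?W = "span (set vs)" and ?W' = "span (set (v # vs))"
    have v: "v \<in> carrier_vec n" and vs: "set vs \<subseteq> carrier_vec n" using Cons.prems by auto
    obtain H where H: "is_orth_proj n ?W H" using Cons.IH vs by blast
    have Hc: "H \<in> carrier_mat n n" using H by (simp add: is_orth_proj_def)
    have WW: "?W \<subseteq> ?W'" by (rule span_is_monotone) auto
    have W'c: "?W' \<subseteq> carrier_vec n" using span_closed[OF Cons.prems] by auto
    have gen: "set (v # vs) \<subseteq> ?W'" by (rule in_own_span[OF Cons.prems])
    have gen0: "set vs \<subseteq> ?W" by (rule in_own_span[OF vs])
    define r where "r = v - H *\<^sub>v v"
    have Hv: "H *\<^sub>v v \<in> carrier_vec n" using Hc v by auto
    have HvW: "H *\<^sub>v v \<in> ?W" using H v by (auto simp: is_orth_proj_def)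
    have r: "r \<in> carrier_vec n" unfolding r_def using v Hv by auto
    have sumW': "a + b \<in> ?W'" if "a \<in> ?W'" "b \<in> ?W'" for a b
      by (rule span_add1[OF Cons.prems that])
    have smW': "c \<cdot>\<^sub>v a \<in> ?W'" if "a \<in> ?W'" for a c
      by (rule smult_in_span[OF Cons.prems that])
    have "r = v + (-1) \<cdot>\<^sub>v (H *\<^sub>v v)" unfolding r_def using v Hv by auto
    moreover have "v \<in> ?W'" using gen by simp
    ultimately have rW': "r \<in> ?W'" using sumW'[OF _ smW'[OF subsetD[OF WW HvW]]] by simp
    define c where "c = inverse (r \<bullet> r)"
    define G where "G = H + mat n n (\<lambda>(i,j). c * r $ i * r $ j)"
    have Gc: "G \<in> carrier_mat n n" unfolding G_def using Hc by auto
    have G: "G *\<^sub>v y = H *\<^sub>v y + (c * (r \<bullet> y)) \<cdot>\<^sub>v r" if y: "y \<in> carrier_vec n" for y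
    proof (rule eq_vecI)
      fix i assume "i < dim_vec (H *\<^sub>v y + (c * (r \<bullet> y)) \<cdot>\<^sub>v r)"
      hence i: "i < n" using r by simp
      show "(G *\<^sub>v y) $ i = (H *\<^sub>v y + (c * (r \<bullet> y)) \<cdot>\<^sub>v r) $ i"
        using i Hc r y unfolding G_def
        by (simp add: scalar_prod_def sum.distrib sum_distrib_left sum_distrib_right algebra_simps)
    qed (use Gc r in auto)
    have r0: "c * (r \<bullet> r) = 1 \<or> r = 0\<^sub>v n"
    proof (cases "r \<bullet> r = 0")
      case True
      hence "(\<Sum>i = 0..<n. r $ i * r $ i) = 0" using r by (auto simp: scalar_prod_def)
      hence "\<forall>i\<in>{0..<n}. r $ i * r $ i = 0" by (subst (asm) sum_nonneg_eq_0_iff) auto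
      hence "r = 0\<^sub>v n" using r by (intro eq_vecI) auto
      thus ?thesis ..
    qed (simp add: c_def)
    have "is_orth_proj n ?W' G"
      unfolding is_orth_proj_def
    proof (intro conjI ballI)
      fix y :: "real vec" assume y: "y \<in> carrier_vec n"
      have Hy: "H *\<^sub>v y \<in> carrier_vec n" and HyW: "H *\<^sub>v y \<in> ?W"
        using H Hc y by (auto simp: is_orth_proj_def)
      show "G *\<^sub>v y \<in> ?W'" unfolding G[OF y]
        by (rule sumW'[OF subsetD[OF WW HyW] smW'[OF rW']])
      fix w assume w: "w \<in> ?W'"
      define u where "u = y - G *\<^sub>v y"
      have u: "u \<in> carrier_vec n" using y Gc unfolding u_def by auto
      have udec: "a \<bullet> u = a \<bullet> (y - H *\<^sub>v y) - c * (r \<bullet> y) * (a \<bullet> r)"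
        if a: "a \<in> carrier_vec n" for a
      proof -
        have "u = (y - H *\<^sub>v y) - (c * (r \<bullet> y)) \<cdot>\<^sub>v r"
          unfolding u_def G[OF y] using y Hy r Hc by (intro eq_vecI) auto
        hence "a \<bullet> u = a \<bullet> (y - H *\<^sub>v y) - a \<bullet> ((c * (r \<bullet> y)) \<cdot>\<^sub>v r)"
          using scalar_prod_minus_distrib[of a n "y - H *\<^sub>v y" "(c * (r \<bullet> y)) \<cdot>\<^sub>v r"] a y Hy r
          by simp
        thus ?thesis using a r by simp
      qed
      have orthW: "a \<bullet> (y - H *\<^sub>v y) = 0" "a \<bullet> r = 0" if "a \<in> ?W" for a
        using that H y v unfolding is_orth_proj_def r_def by auto
      have Wc: "?W \<subseteq> carrier_vec n" using WW W'c by blast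
      have aW: "a \<bullet> u = 0" if "a \<in> ?W" for a
        using udec[of a] orthW[OF that] that Wc by auto
      have ru: "r \<bullet> u = 0"
      proof (cases "r = 0\<^sub>v n")
        case True thus ?thesis using u by simp
      next
        case False
        hence 1: "c * (r \<bullet> r) = 1" using r0 by blast
        have "r \<bullet> (H *\<^sub>v y) = 0"
          using orthW(2)[OF HyW] comm_scalar_prod[OF Hy r] by simp
        hence "r \<bullet> (y - H *\<^sub>v y) = r \<bullet> y"
          using scalar_prod_minus_distrib[OF r y Hy] by simp
        moreover have "c * (r \<bullet> y) * (r \<bullet> r) = (r \<bullet> y) * (c * (r \<bullet> r))" by simp
        ultimately show ?thesis using udec[OF r] 1 by simp
      qed
      have "v = r + H *\<^sub>v v" unfolding r_def using v Hv Hc by (intro eq_vecI) auto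
      hence "v \<bullet> u = r \<bullet> u + (H *\<^sub>v v) \<bullet> u" using add_scalar_prod_distrib[OF r Hv u] by simp
      hence vu: "v \<bullet> u = 0" using ru aW[OF HvW] by simp
      have "w \<bullet> u = 0"
      proof (rule lincomb_orthogonal[OF Cons.prems u _ w])
        fix z assume "z \<in> set (v # vs)"
        thus "z \<bullet> u = 0" using vu aW gen0 by auto
      qed
      thus "w \<bullet> (y - G *\<^sub>v y) = 0" by (simp add: u_def)
    qed (fact Gc)
    thus ?case by blast
  qed
qed

lemma hat_mat_is_orth_proj:
  "is_orth_proj n (vec_space.col_space n (design_mat n x s)) (hat_mat n x s)"
proof -
  interpret vec_space "TYPE(real)" n .
  let ?A = "design_mat n x s"
  have A: "set (cols ?A) \<subseteq> carrier_vec n"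
    using cols_dim[of ?A] by (simp add: design_mat_def)
  have diff: "a - b \<in> span (set (cols ?A))"
    if ab: "a \<in> span (set (cols ?A))" "b \<in> span (set (cols ?A))" for a b
  proof -
    have "a \<in> carrier_vec n" "b \<in> carrier_vec n" using span_closed[OF A] ab by auto
    hence "a - b = a + (-1) \<cdot>\<^sub>v b" by auto
    thus ?thesis using span_add1[OF A ab(1) smult_in_span[OF A ab(2), of "-1"]] by simp
  qed
  have "H = G" if "is_orth_proj n (span (set (cols ?A))) H" "is_orth_proj n (span (set (cols ?A))) G"
    for H G
    using is_orth_proj_unique[OF _ diff that] span_closed[OF A] by auto
  hence "\<exists>!H. is_orth_proj n (span (set (cols ?A))) H"
    using is_orth_proj_exists[OF A] by auto
  thus ?thesis unfolding hat_mat_def col_space_def by (rule theI')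
qed

end

theory Submission
  imports Defs "HOL-Real_Asymp.Real_Asymp"
begin

text \<open>
  Let \<open>L > 1\<close> and \<open>\<eta> > 0\<close> be parameters to be chosen. For orthonormal
  \<open>u\<^sub>1, \<dots>, u\<^sub>m\<close>, writing each factor of \<open>exp (l (u\<^sub>j \<bullet> \<epsilon>)\<^sup>2)\<close> as the moment generating function of a
  Gaussian and exchanging the integrals gives \<open>E exp (l \<Sum> (u\<^sub>j \<bullet> \<epsilon>)\<^sup>2) \<le> (1 - 2 l b\<^sup>2) powr (-m/2)\<close>. With
  \<open>1 - 2 l b\<^sup>2 = 1/L\<close>, an overfitting model with \<open>m\<close> superfluous predictors beats \<open>s\<^sub>0\<close> with probability
  at most \<open>q ^ m\<close>, where \<open>ln q\<close> is about
  \<open>- (1 - 1/L) (1 - 2 \<eta>) (\<sigma>\<^sup>2 / (2 b\<^sup>2)) (ln n + 2 \<gamma> ln p) + ln L / 2\<close> and \<open>\<eta>\<close> absorbs the deviation of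
  \<open>RSS(s\<^sub>0)\<close> from \<open>n \<sigma>\<^sup>2\<close>. The union bound over all supersets of \<open>s\<^sub>0\<close> costs \<open>(1 + q) ^ p - 1\<close>, so the
  three regimes for \<open>\<gamma>\<close> amount to \<open>p q \<longlonglongrightarrow> 0\<close>: constant \<open>L\<close> and \<open>\<eta>\<close> suffice off the critical value of \<open>\<gamma>\<close>,
  while \<open>L = 1 + sqrt (ln p)\<close> and \<open>\<eta> = 1 / ln n\<close> work at it. A model missing a true predictor
  has bias at least a large multiple of \<open>p\<^sub>0 ln p\<close>, which dominates both its noise terms and the
  logarithm of the number of such models.
\<close>

subsection \<open>Tail bounds for linear and quadratic forms of subgaussian noise\<close>

text \<open>The recursion matches the inductions that add one direction at a time. Each pair is
  tested in one order only, which suffices because the scalar product is symmetric. Lists are used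
  because their length bounds the number of directions.\<close>

fun orthonormal :: "nat \<Rightarrow> real vec list \<Rightarrow> bool" where
  "orthonormal n [] \<longleftrightarrow> True"
| "orthonormal n (u # us) \<longleftrightarrow>
     u \<in> carrier_vec n \<and> u \<bullet> u = 1 \<and> (\<forall>v\<in>set us. v \<bullet> u = 0) \<and> orthonormal n us"

section \<open>Gaussian integrals and elementary inequalities\<close>

lemma nn_integral_normal_density:
  "\<sigma> > 0 \<Longrightarrow> (\<integral>\<^sup>+z. ennreal (normal_density \<mu> \<sigma> z) \<partial>lborel) = 1"
  by (subst nn_integral_eq_integral) auto

text \<open>Completing the square: the factor \<open>exp (a * z)\<close> moves the mean of the
  standard normal density from 0 to \<open>a\<close> and multiplies its mass by
  \<open>exp (a\<^sup>2 / 2)\<close>.\<close>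

lemma gaussian_mgf:
  "(\<integral>\<^sup>+z. ennreal (std_normal_density z * exp (a * z)) \<partial>lborel) = ennreal (exp (a\<^sup>2 / 2))"
proof -
  have "std_normal_density z * exp (a * z) = exp (a\<^sup>2 / 2) * normal_density a 1 z" for z
    by (simp add: normal_density_def exp_add[symmetric] power2_eq_square field_simps)
  hence "(\<integral>\<^sup>+z. ennreal (std_normal_density z * exp (a * z)) \<partial>lborel)
       = (\<integral>\<^sup>+z. ennreal (exp (a\<^sup>2 / 2)) * ennreal (normal_density a 1 z) \<partial>lborel)"
    by (simp add: ennreal_mult)
  also have "\<dots> = ennreal (exp (a\<^sup>2 / 2))"
    by (subst nn_integral_cmult) (auto simp: nn_integral_normal_density)
  finally show ?thesis .
qed

text \<open>The quadratic tilt rescales the standard normal density to a centred one with standard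
  deviation \<open>s = 1 / sqrt (1 - 2 * c)\<close>, at the price of the factor
  \<open>s\<close>.\<close>

lemma gaussian_exp_square:
  fixes c :: real
  assumes "2 * c < 1"
  shows "(\<integral>\<^sup>+z. ennreal (std_normal_density z * exp (c * z\<^sup>2)) \<partial>lborel) = ennreal (1 / sqrt (1 - 2 * c))"
proof -
  define s where "s = 1 / sqrt (1 - 2 * c)"
  have s: "s > 0" "s\<^sup>2 = 1 / (1 - 2 * c)" using assms by (auto simp: s_def power_divide)
  have "std_normal_density z * exp (c * z\<^sup>2) = s * normal_density 0 s z" for z
  proof -
    have "- z\<^sup>2 / 2 + c * z\<^sup>2 = - (z\<^sup>2 / (2 * s\<^sup>2))"
      using assms unfolding s by (simp add: field_simps)
    moreover have "1 / sqrt (2 * pi) = s * (1 / sqrt (2 * pi * s\<^sup>2))"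
      using s(1) by (simp add: real_sqrt_mult)
    ultimately show ?thesis
      unfolding normal_density_def by (simp add: exp_add[symmetric])
  qed
  hence "(\<integral>\<^sup>+z. ennreal (std_normal_density z * exp (c * z\<^sup>2)) \<partial>lborel)
       = (\<integral>\<^sup>+z. ennreal s * ennreal (normal_density 0 s z) \<partial>lborel)"
    using s by (simp add: ennreal_mult)
  also have "\<dots> = ennreal s"
    using s by (subst nn_integral_cmult) (auto simp: nn_integral_normal_density)
  finally show ?thesis by (simp add: s_def)
qed

lemma borel_measurable_sum_list [measurable (raw)]:
  fixes f :: "'c \<Rightarrow> 'a \<Rightarrow> real"
  assumes "\<And>u. f u \<in> borel_measurable N"
  shows "(\<lambda>\<omega>. \<Sum>u\<leftarrow>us. f u \<omega>) \<in> borel_measurable N"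
  using assms by (induction us) auto

lemma orthonormal_unit_vecs:
  "distinct is \<Longrightarrow> set is \<subseteq> {..<n} \<Longrightarrow> orthonormal n (map (unit_vec n) is)"
  by (induction "is") auto

text \<open>The right-hand side times the Taylor bound \<open>1 + y + y\<^sup>2 / 2\<close> for
  \<open>exp y\<close> equals \<open>1 + y ^ 4 / 4\<close>, hence is at least 1, so the right-hand
  side is at least the reciprocal of \<open>exp y\<close>.\<close>

lemma exp_minus_le_quadratic:
  fixes y :: real
  assumes "y \<ge> 0"
  shows "exp (- y) \<le> 1 - y + y\<^sup>2 / 2"
proof -
  have "(1 - y + y\<^sup>2 / 2) * (1 + y + y\<^sup>2 / 2) = 1 + y ^ 4 / 4"
    by (simp add: power2_eq_square power4_eq_xxxx algebra_simps)
  hence "1 \<le> (1 - y + y\<^sup>2 / 2) * (1 + y + y\<^sup>2 / 2)" by simp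
  moreover have "1 - y + y\<^sup>2 / 2 \<ge> 0"
    using zero_le_power2[of "y - 1"] by (simp add: power2_eq_square algebra_simps)
  ultimately have "1 \<le> (1 - y + y\<^sup>2 / 2) * exp y"
    using exp_lower_Taylor_quadratic[OF assms] by (meson mult_left_mono order_trans)
  thus ?thesis by (simp add: exp_minus field_simps)
qed

section \<open>Exponential moments and Chernoff bounds for independent subgaussian noise\<close>

locale subgaussian_noise = prob_space M for M :: "'a measure" +
  fixes e :: "nat \<Rightarrow> 'a \<Rightarrow> real" and n :: nat and b :: real
  assumes indep: "indep_vars (\<lambda>_. borel) e {1..n}"
    and subgaussian: "\<And>i. i \<in> {1..n} \<Longrightarrow> subgaussian b M (e i)"
    and b_pos: "b > 0"
begin

definition noise :: "'a \<Rightarrow> real vec" where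
  "noise \<omega> = vec n (\<lambda>i. e (Suc i) \<omega>)"

lemma noise_carrier [simp]: "noise \<omega> \<in> carrier_vec n"
  by (simp add: noise_def)

lemma dim_noise [simp]: "dim_vec (noise \<omega>) = n"
  by (simp add: noise_def)

lemma measurable_e [measurable]: "i \<in> {1..n} \<Longrightarrow> e i \<in> borel_measurable M"
  using subgaussian by (auto simp: subgaussian_def)

lemma scalar_prod_noise:
  "w \<bullet> noise \<omega> = (\<Sum>i\<in>{1..n}. w $ (i - 1) * e i \<omega>)"
proof -
  have "w \<bullet> noise \<omega> = (\<Sum>i\<in>{0..<n}. w $ i * e (Suc i) \<omega>)"
    by (simp add: scalar_prod_def noise_def)
  also have "\<dots> = (\<Sum>i\<in>{1..n}. w $ (i - 1) * e i \<omega>)"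
    by (rule sum.reindex_bij_witness[of _ "\<lambda>i. i - 1" Suc]) auto
  finally show ?thesis .
qed

lemma measurable_scalar_prod_noise [measurable]: "(\<lambda>\<omega>. w \<bullet> noise \<omega>) \<in> borel_measurable M"
  unfolding scalar_prod_noise by measurable

text \<open>Independence factors the exponential over the coordinates, and coordinate
  \<open>i\<close> is bounded by subgaussianity with the entry of \<open>w\<close> in the role of
  \<open>t\<close>. Integrals of nonnegative functions avoid separate integrability
  arguments.\<close>

lemma exp_linear_bound:
  assumes w: "w \<in> carrier_vec n"
  shows "(\<integral>\<^sup>+\<omega>. ennreal (exp (w \<bullet> noise \<omega>)) \<partial>M) \<le> ennreal (exp (b\<^sup>2 * (w \<bullet> w) / 2))"
proof -
  have "(\<integral>\<^sup>+\<omega>. ennreal (exp (w \<bullet> noise \<omega>)) \<partial>M) =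
        (\<integral>\<^sup>+\<omega>. (\<Prod>i\<in>{1..n}. ennreal (exp (w $ (i - 1) * e i \<omega>))) \<partial>M)"
    by (simp add: scalar_prod_noise exp_sum prod_ennreal)
  also have "\<dots> = (\<Prod>i\<in>{1..n}. \<integral>\<^sup>+\<omega>. ennreal (exp (w $ (i - 1) * e i \<omega>)) \<partial>M)"
    by (intro indep_vars_nn_integral indep_vars_compose2[OF indep]) auto
  also have "\<dots> \<le> (\<Prod>i\<in>{1..n}. ennreal (exp (b\<^sup>2 * (w $ (i - 1))\<^sup>2 / 2)))"
  proof (intro prod_mono_ennreal)
    fix i assume i: "i \<in> {1..n}"
    show "(\<integral>\<^sup>+\<omega>. ennreal (exp (w $ (i - 1) * e i \<omega>)) \<partial>M) \<le> ennreal (exp (b\<^sup>2 * (w $ (i - 1))\<^sup>2 / 2))"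
      using subgaussian[OF i] unfolding subgaussian_def
      by (subst nn_integral_eq_integral) (auto intro!: ennreal_leI)
  qed
  also have "\<dots> = ennreal (exp (\<Sum>i\<in>{1..n}. b\<^sup>2 * (w $ (i - 1))\<^sup>2 / 2))"
    by (simp add: exp_sum prod_ennreal)
  also have "(\<Sum>i\<in>{1..n}. b\<^sup>2 * (w $ (i - 1))\<^sup>2 / 2) = (\<Sum>i\<in>{0..<n}. b\<^sup>2 * (w $ i)\<^sup>2 / 2)"
    by (rule sum.reindex_bij_witness[of _ Suc "\<lambda>i. i - 1"]) auto
  also have "\<dots> = b\<^sup>2 * (w \<bullet> w) / 2"
    using w by (simp add: scalar_prod_def power2_eq_square sum_distrib_left sum_divide_distrib)
  finally show ?thesis .
qed

text \<open>Induction on \<open>us\<close>. The linear term \<open>w\<close> makes the induction go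
  through: replacing the square for \<open>u\<close> by a Gaussian average turns it into a linear
  form, which \<open>w\<close> absorbs. Orthogonality keeps the enlarged \<open>w\<close>
  perpendicular to the remaining directions.\<close>

lemma exp_quadratic_bound:
  assumes "orthonormal n us" "w \<in> carrier_vec n" "\<And>u. u \<in> set us \<Longrightarrow> u \<bullet> w = 0"
    and l: "0 \<le> l" "2 * l * b\<^sup>2 < 1"
  shows "(\<integral>\<^sup>+\<omega>. ennreal (exp (w \<bullet> noise \<omega> + l * (\<Sum>u\<leftarrow>us. (u \<bullet> noise \<omega>)\<^sup>2))) \<partial>M)
      \<le> ennreal (exp (b\<^sup>2 * (w \<bullet> w) / 2) * (1 / sqrt (1 - 2 * l * b\<^sup>2)) ^ length us)"
  using assms(1-3)
proof (induction us arbitrary: w)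
  case Nil
  thus ?case using exp_linear_bound[of w] by simp
next
  case (Cons u us)
  define K where "K = 1 / sqrt (1 - 2 * l * b\<^sup>2)"
  have K: "K > 0" using l by (simp add: K_def)
  have u: "u \<in> carrier_vec n" "u \<bullet> u = 1" and us: "\<And>v. v \<in> set us \<Longrightarrow> v \<bullet> u = 0" "orthonormal n us"
    and w: "w \<in> carrier_vec n" "u \<bullet> w = 0" and usw: "\<And>v. v \<in> set us \<Longrightarrow> v \<bullet> w = 0"
    using Cons.prems by auto
  have usc: "v \<in> carrier_vec n" if "v \<in> set us" for v
  proof -
    have "orthonormal n vs \<Longrightarrow> v \<in> set vs \<Longrightarrow> v \<in> carrier_vec n" for vs
      by (induction vs) auto
    thus ?thesis using that us by blast
  qed
  \<comment> \<open>With this \<open>a\<close>, the Gaussian average of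
    \<open>exp (a * z * (u \<bullet> noise \<omega>))\<close> over \<open>z\<close> is
    \<open>exp (l * (u \<bullet> noise \<omega>)\<^sup>2)\<close>.\<close>
  define a where "a = sqrt (2 * l)"
  have a2: "a\<^sup>2 = 2 * l" using l by (simp add: a_def)
  define f where "f z \<omega> = ennreal (std_normal_density z * exp ((w + (a * z) \<cdot>\<^sub>v u) \<bullet> noise \<omega>
                             + l * (\<Sum>u\<leftarrow>us. (u \<bullet> noise \<omega>)\<^sup>2)))" for z \<omega>
  have fdec: "(w + (a * z) \<cdot>\<^sub>v u) \<bullet> noise \<omega> = w \<bullet> noise \<omega> + a * z * (u \<bullet> noise \<omega>)" for z \<omega>
    using u w by (simp add: add_scalar_prod_distrib[of _ n])
  have fm: "(\<lambda>(z, \<omega>). f z \<omega>) \<in> borel_measurable (lborel \<Otimes>\<^sub>M M)"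
    unfolding f_def fdec by measurable
  interpret P: pair_sigma_finite lborel M ..
  have "(\<integral>\<^sup>+\<omega>. ennreal (exp (w \<bullet> noise \<omega> + l * (\<Sum>u\<leftarrow>u # us. (u \<bullet> noise \<omega>)\<^sup>2))) \<partial>M)
      = (\<integral>\<^sup>+\<omega>. (\<integral>\<^sup>+z. f z \<omega> \<partial>lborel) \<partial>M)"
  proof (rule nn_integral_cong)
    fix \<omega>
    have "(\<integral>\<^sup>+z. f z \<omega> \<partial>lborel) = (\<integral>\<^sup>+z. ennreal (exp (w \<bullet> noise \<omega> + l * (\<Sum>u\<leftarrow>us. (u \<bullet> noise \<omega>)\<^sup>2)))
              * ennreal (std_normal_density z * exp ((a * (u \<bullet> noise \<omega>)) * z)) \<partial>lborel)"
      unfolding f_def fdec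
      by (intro nn_integral_cong) (simp add: ennreal_mult[symmetric] exp_add algebra_simps)
    also have "\<dots> = ennreal (exp (w \<bullet> noise \<omega> + l * (\<Sum>u\<leftarrow>us. (u \<bullet> noise \<omega>)\<^sup>2))) *
                  ennreal (exp ((a * (u \<bullet> noise \<omega>))\<^sup>2 / 2))"
      by (subst nn_integral_cmult) (simp_all only: gaussian_mgf, simp)
    also have "\<dots> = ennreal (exp (w \<bullet> noise \<omega> + l * (\<Sum>u\<leftarrow>u # us. (u \<bullet> noise \<omega>)\<^sup>2)))"
      by (simp add: ennreal_mult[symmetric] exp_add[symmetric] power_mult_distrib a2 algebra_simps)
    finally show "ennreal (exp (w \<bullet> noise \<omega> + l * (\<Sum>u\<leftarrow>u # us. (u \<bullet> noise \<omega>)\<^sup>2))) = (\<integral>\<^sup>+z. f z \<omega> \<partial>lborel)" ..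
  qed
  also have "\<dots> = (\<integral>\<^sup>+z. (\<integral>\<^sup>+\<omega>. f z \<omega> \<partial>M) \<partial>lborel)"
    by (rule P.Fubini'[OF fm])
  also have "\<dots> \<le> (\<integral>\<^sup>+z. ennreal (exp (b\<^sup>2 * (w \<bullet> w) / 2) * K ^ length us)
                      * ennreal (std_normal_density z * exp ((l * b\<^sup>2) * z\<^sup>2)) \<partial>lborel)"
  proof (rule nn_integral_mono)
    fix z
    let ?w = "w + (a * z) \<cdot>\<^sub>v u"
    have wc: "?w \<in> carrier_vec n" using w u by simp
    have orth: "v \<bullet> ?w = 0" if "v \<in> set us" for v
      using that us usw usc[OF that] w u by (simp add: scalar_prod_add_distrib[of _ n])
    have wu: "w \<bullet> u = 0" using w u comm_scalar_prod by metis
    \<comment> \<open>Pythagoras: the shift along \<open>u\<close> adds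
      \<open>2 * l * z\<^sup>2\<close> to the squared norm, so the induction hypothesis leaves the
      factor \<open>exp (l * b\<^sup>2 * z\<^sup>2)\<close> to be integrated over
      \<open>z\<close>.\<close>
    have ww: "?w \<bullet> ?w = w \<bullet> w + 2 * l * z\<^sup>2"
    proof -
      have "?w \<bullet> ?w = w \<bullet> ?w + (a * z) * (u \<bullet> ?w)"
        using w u by (simp add: add_scalar_prod_distrib[of _ n])
      also have "w \<bullet> ?w = w \<bullet> w" using w u wu by (simp add: scalar_prod_add_distrib[of _ n])
      also have "u \<bullet> ?w = a * z" using w u by (simp add: scalar_prod_add_distrib[of _ n])
      finally show ?thesis using a2 by (simp add: power2_eq_square)
    qed
    have "(\<integral>\<^sup>+\<omega>. f z \<omega> \<partial>M) = ennreal (std_normal_density z) *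
       (\<integral>\<^sup>+\<omega>. ennreal (exp (?w \<bullet> noise \<omega> + l * (\<Sum>u\<leftarrow>us. (u \<bullet> noise \<omega>)\<^sup>2))) \<partial>M)"
      unfolding f_def by (subst nn_integral_cmult[symmetric]) (auto simp: ennreal_mult)
    also have "\<dots> \<le> ennreal (std_normal_density z) * ennreal (exp (b\<^sup>2 * (?w \<bullet> ?w) / 2) * K ^ length us)"
      unfolding K_def by (intro mult_left_mono Cons.IH[OF us(2) wc orth]) auto
    also have "\<dots> = ennreal (exp (b\<^sup>2 * (w \<bullet> w) / 2) * K ^ length us)
                      * ennreal (std_normal_density z * exp ((l * b\<^sup>2) * z\<^sup>2))"
      unfolding ww using K
      by (simp add: ennreal_mult[symmetric] exp_add[symmetric] algebra_simps add_divide_distrib)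
    finally show "(\<integral>\<^sup>+\<omega>. f z \<omega> \<partial>M) \<le> \<dots>" .
  qed
  also have "\<dots> = ennreal (exp (b\<^sup>2 * (w \<bullet> w) / 2) * K ^ length us) * ennreal K"
    using l by (subst nn_integral_cmult) (simp_all only: K_def, simp, subst gaussian_exp_square, auto simp: algebra_simps)
  also have "\<dots> = ennreal (exp (b\<^sup>2 * (w \<bullet> w) / 2) * K ^ length (u # us))"
    using K by (simp add: ennreal_mult[symmetric] algebra_simps)
  finally show ?case unfolding K_def .
qed

text \<open>Chernoff bound with \<open>l\<close> parametrised by \<open>L\<close>:
  \<open>1 - 2 * l * b\<^sup>2\<close> becomes \<open>1 / L\<close>, so each direction costs a
  factor \<open>sqrt L\<close>. Large \<open>L\<close> improves the exponent and worsens this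
  factor.\<close>

lemma emeasure_quadratic_tail:
  assumes us: "orthonormal n us" "length us \<le> m" and L: "L > 1"
  shows "emeasure M {\<omega> \<in> space M. t \<le> (\<Sum>u\<leftarrow>us. (u \<bullet> noise \<omega>)\<^sup>2)}
      \<le> ennreal (exp (- ((1 - 1 / L) / (2 * b\<^sup>2)) * t) * sqrt L ^ m)"
proof -
  define l where "l = (1 - 1 / L) / (2 * b\<^sup>2)"
  have l: "l > 0" "2 * l * b\<^sup>2 = 1 - 1 / L" using L b_pos by (auto simp: l_def field_simps)
  have "emeasure M {\<omega> \<in> space M. t \<le> (\<Sum>u\<leftarrow>us. (u \<bullet> noise \<omega>)\<^sup>2)}
     \<le> ennreal (exp (- l * t)) * (\<integral>\<^sup>+\<omega>\<in>space M. ennreal (exp (l * (\<Sum>u\<leftarrow>us. (u \<bullet> noise \<omega>)\<^sup>2))) \<partial>M)"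
    by (rule Chernoff_ineq_nn_integral_ge[OF l(1)]) auto
  also have "(\<integral>\<^sup>+\<omega>\<in>space M. ennreal (exp (l * (\<Sum>u\<leftarrow>us. (u \<bullet> noise \<omega>)\<^sup>2))) \<partial>M)
     = (\<integral>\<^sup>+\<omega>. ennreal (exp (0\<^sub>v n \<bullet> noise \<omega> + l * (\<Sum>u\<leftarrow>us. (u \<bullet> noise \<omega>)\<^sup>2))) \<partial>M)"
    by (intro nn_integral_cong) simp
  also have "\<dots> \<le> ennreal (exp (b\<^sup>2 * (0\<^sub>v n \<bullet> 0\<^sub>v n) / 2) * (1 / sqrt (1 - 2 * l * b\<^sup>2)) ^ length us)"
  proof (rule exp_quadratic_bound[OF us(1)])
    fix u assume "u \<in> set us"
    moreover have "orthonormal n vs \<Longrightarrow> u \<in> set vs \<Longrightarrow> u \<in> carrier_vec n" for vs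
      by (induction vs) auto
    ultimately show "u \<bullet> 0\<^sub>v n = 0" using us by simp
  qed (use l L in auto)
  also have "\<dots> = ennreal (sqrt L ^ length us)"
    using L by (simp add: l real_sqrt_divide)
  also have "\<dots> \<le> ennreal (sqrt L ^ m)"
    using us L by (intro ennreal_leI power_increasing) auto
  finally show ?thesis
    using L by (simp add: ennreal_mult l_def mult_left_mono)
qed

lemma quadratic_tail:
  assumes "orthonormal n us" "length us \<le> m" "L > 1"
  shows "prob {\<omega> \<in> space M. t \<le> (\<Sum>u\<leftarrow>us. (u \<bullet> noise \<omega>)\<^sup>2)}
      \<le> exp (- ((1 - 1 / L) / (2 * b\<^sup>2)) * t) * sqrt L ^ m"
  using emeasure_quadratic_tail[OF assms, of t] assms(3) by (simp add: emeasure_eq_measure)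

text \<open>Chernoff bound for the linear form. The choice \<open>t = 1 / (8 * b\<^sup>2)\<close>
  minimises the exponent, a multiple \<open>- t / 8 + b\<^sup>2 * t\<^sup>2 / 2\<close> of
  \<open>w \<bullet> w\<close>.\<close>

lemma linear_tail:
  assumes w: "w \<in> carrier_vec n"
  shows "prob {\<omega> \<in> space M. w \<bullet> noise \<omega> \<le> - (w \<bullet> w) / 8} \<le> exp (- (w \<bullet> w) / (128 * b\<^sup>2))"
proof -
  define t where "t = 1 / (8 * b\<^sup>2)"
  have t: "t > 0" using b_pos by (simp add: t_def)
  have "emeasure M {\<omega> \<in> space M. w \<bullet> noise \<omega> \<le> - (w \<bullet> w) / 8}
     \<le> ennreal (exp (t * (- (w \<bullet> w) / 8))) * (\<integral>\<^sup>+\<omega>\<in>space M. ennreal (exp (- t * (w \<bullet> noise \<omega>))) \<partial>M)"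
    by (rule Chernoff_ineq_nn_integral_le[OF t]) auto
  also have "(\<integral>\<^sup>+\<omega>\<in>space M. ennreal (exp (- t * (w \<bullet> noise \<omega>))) \<partial>M)
     = (\<integral>\<^sup>+\<omega>. ennreal (exp (((- t) \<cdot>\<^sub>v w) \<bullet> noise \<omega>)) \<partial>M)"
    using w by (intro nn_integral_cong) simp
  also have "\<dots> \<le> ennreal (exp (b\<^sup>2 * (((- t) \<cdot>\<^sub>v w) \<bullet> ((- t) \<cdot>\<^sub>v w)) / 2))"
    using w by (intro exp_linear_bound) auto
  also have "ennreal (exp (t * (- (w \<bullet> w) / 8))) * \<dots> = ennreal (exp (- (w \<bullet> w) / (128 * b\<^sup>2)))"
    using w b_pos
    by (simp add: ennreal_mult[symmetric] exp_add[symmetric] t_def power2_eq_square field_simps)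
  finally show ?thesis by (simp add: emeasure_eq_measure mult_left_mono)
qed

section \<open>Concentration of the squared norm of the noise\<close>

lemma noise_norm: "noise \<omega> \<bullet> noise \<omega> = (\<Sum>i\<in>{1..n}. (e i \<omega>)\<^sup>2)"
proof -
  have "noise \<omega> \<bullet> noise \<omega> = (\<Sum>i\<in>{1..n}. noise \<omega> $ (i - 1) * e i \<omega>)"
    by (rule scalar_prod_noise)
  also have "\<dots> = (\<Sum>i\<in>{1..n}. (e i \<omega>)\<^sup>2)"
    by (intro sum.cong) (auto simp: noise_def power2_eq_square)
  finally show ?thesis .
qed

lemma measurable_noise_norm [measurable]: "(\<lambda>\<omega>. noise \<omega> \<bullet> noise \<omega>) \<in> borel_measurable M"
  unfolding noise_norm by measurable

lemma unit_vec_noise: "i < n \<Longrightarrow> unit_vec n i \<bullet> noise \<omega> = e (Suc i) \<omega>"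
  by (simp add: scalar_prod_left_unit[of _ n] noise_def)

text \<open>The squared norm is the quadratic form of the standard basis. With \<open>L = 2\<close>
  the threshold makes the Chernoff exponent equal to \<open>- n\<close>, while the \<open>n\<close>
  directions contribute \<open>sqrt 2 ^ n\<close>; the resulting base is below 1.\<close>

lemma norm_upper_tail:
  "prob {\<omega> \<in> space M. 4 * b\<^sup>2 * n \<le> noise \<omega> \<bullet> noise \<omega>} \<le> (sqrt 2 / exp 1) ^ n"
proof -
  let ?us = "map (unit_vec n) [0..<n]"
  have *: "(\<Sum>u\<leftarrow>?us. (u \<bullet> noise \<omega>)\<^sup>2) = noise \<omega> \<bullet> noise \<omega>" for \<omega>
  proof -
    have "(\<Sum>u\<leftarrow>?us. (u \<bullet> noise \<omega>)\<^sup>2) = (\<Sum>i\<in>{0..<n}. (unit_vec n i \<bullet> noise \<omega>)\<^sup>2)"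
      by (simp add: sum_list_distinct_conv_sum_set o_def)
    also have "\<dots> = (\<Sum>i\<in>{1..n}. (e i \<omega>)\<^sup>2)"
      by (rule sum.reindex_bij_witness[of _ "\<lambda>i. i - 1" Suc]) (auto simp: unit_vec_noise simp del: scalar_prod_left_unit)
    finally show ?thesis by (simp add: noise_norm)
  qed
  have "orthonormal n ?us" by (rule orthonormal_unit_vecs) auto
  from quadratic_tail[OF this, of n 2 "4 * b\<^sup>2 * n"]
  have "prob {\<omega> \<in> space M. 4 * b\<^sup>2 * n \<le> noise \<omega> \<bullet> noise \<omega>}
      \<le> exp (- ((1 - 1 / 2) / (2 * b\<^sup>2)) * (4 * b\<^sup>2 * n)) * sqrt 2 ^ n"
    unfolding * by simp
  also have "- ((1 - 1 / 2) / (2 * b\<^sup>2)) * (4 * b\<^sup>2 * n) = n * (- 1 :: real)"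
    using b_pos by simp
  also have "exp (n * (- 1 :: real)) * sqrt 2 ^ n = (sqrt 2 / exp 1) ^ n"
    unfolding exp_of_nat_mult by (simp add: exp_minus power_divide divide_simps)
  finally show ?thesis .
qed

text \<open>From \<open>y\<^sup>2 / 2 \<le> exp y\<close> with
  \<open>y = x\<^sup>2 / (4 * b\<^sup>2)\<close>, the fourth power is at most
  \<open>32 * b ^ 4\<close> times an exponential of the square. The quadratic bound for a single
  unit vector gives that exponential mean at most \<open>sqrt 2\<close>.\<close>

lemma fourth_moment:
  assumes i: "i \<in> {1..n}"
  shows "integrable M (\<lambda>\<omega>. (e i \<omega>) ^ 4)" "expectation (\<lambda>\<omega>. (e i \<omega>) ^ 4) \<le> 64 * b ^ 4"
proof -
  note [measurable] = measurable_e[OF i]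
  let ?u = "unit_vec n (i - Suc 0) :: real vec"
  have u: "?u \<bullet> noise \<omega> = e i \<omega>" for \<omega> using i unit_vec_noise[of "i - Suc 0"] by auto
  have "x ^ 4 \<le> 32 * b ^ 4 * exp (1 / (4 * b\<^sup>2) * x\<^sup>2)" for x :: real
  proof -
    have "(1 / (4 * b\<^sup>2) * x\<^sup>2)\<^sup>2 / 2 \<le> exp (1 / (4 * b\<^sup>2) * x\<^sup>2)"
    proof -
      have "0 \<le> 1 / (4 * b\<^sup>2) * x\<^sup>2" by simp
      from exp_lower_Taylor_quadratic[OF this] this show ?thesis by linarith
    qed
    moreover have "(1 / (4 * b\<^sup>2) * x\<^sup>2)\<^sup>2 / 2 = x ^ 4 / (32 * b ^ 4)"
      by (simp add: power2_eq_square power4_eq_xxxx)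
    ultimately show ?thesis using b_pos by (simp add: pos_divide_le_eq mult.commute)
  qed
  hence "(\<integral>\<^sup>+\<omega>. ennreal ((e i \<omega>) ^ 4) \<partial>M)
      \<le> (\<integral>\<^sup>+\<omega>. ennreal (32 * b ^ 4) * ennreal (exp (1 / (4 * b\<^sup>2) * (e i \<omega>)\<^sup>2)) \<partial>M)"
    by (intro nn_integral_mono) (simp add: ennreal_mult[symmetric])
  also have "\<dots> = ennreal (32 * b ^ 4) * (\<integral>\<^sup>+\<omega>. ennreal (exp (0\<^sub>v n \<bullet> noise \<omega>
                     + 1 / (4 * b\<^sup>2) * (\<Sum>u\<leftarrow>[?u]. (u \<bullet> noise \<omega>)\<^sup>2))) \<partial>M)"
    by (subst nn_integral_cmult) (simp_all add: u)
  also have "\<dots> \<le> ennreal (32 * b ^ 4) * ennreal (exp (b\<^sup>2 * (0\<^sub>v n \<bullet> 0\<^sub>v n) / 2)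
                     * (1 / sqrt (1 - 2 * (1 / (4 * b\<^sup>2)) * b\<^sup>2)) ^ length [?u])"
  proof (rule mult_left_mono)
    show "(\<integral>\<^sup>+\<omega>. ennreal (exp (0\<^sub>v n \<bullet> noise \<omega> + 1 / (4 * b\<^sup>2) * (\<Sum>u\<leftarrow>[?u]. (u \<bullet> noise \<omega>)\<^sup>2))) \<partial>M)
        \<le> ennreal (exp (b\<^sup>2 * (0\<^sub>v n \<bullet> 0\<^sub>v n) / 2)
                     * (1 / sqrt (1 - 2 * (1 / (4 * b\<^sup>2)) * b\<^sup>2)) ^ length [?u])"
      using i b_pos by (intro exp_quadratic_bound[of "[?u]" "0\<^sub>v n" "1 / (4 * b\<^sup>2)"]) auto
  qed simp
  also have "\<dots> = ennreal (32 * b ^ 4 * sqrt 2)"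
    using b_pos by (simp add: ennreal_mult[symmetric] real_sqrt_divide)
  also have "\<dots> \<le> ennreal (64 * b ^ 4)"
    using b_pos real_sqrt_le_mono[of 2 4] by (intro ennreal_leI) simp
  finally have *: "(\<integral>\<^sup>+\<omega>. ennreal ((e i \<omega>) ^ 4) \<partial>M) \<le> ennreal (64 * b ^ 4)" .
  show int: "integrable M (\<lambda>\<omega>. (e i \<omega>) ^ 4)"
    using * by (intro integrableI_bounded) (auto simp: less_top[symmetric] top_unique)
  show "expectation (\<lambda>\<omega>. (e i \<omega>) ^ 4) \<le> 64 * b ^ 4"
    using * int b_pos by (subst (asm) nn_integral_eq_integral) auto
qed

text \<open>Supplies the lower bound \<sigma> squared on the second moment in the lower tail. An
  inequality is enough there, so the mean of the errors is never computed.\<close>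

lemma second_moment:
  assumes i: "i \<in> {1..n}"
  shows "integrable M (\<lambda>\<omega>. (e i \<omega>)\<^sup>2)" "variance (e i) \<le> expectation (\<lambda>\<omega>. (e i \<omega>)\<^sup>2)"
proof -
  note [measurable] = measurable_e[OF i]
  have int1: "integrable M (\<lambda>\<omega>. 1 + (e i \<omega>) ^ 4)"
    using fourth_moment(1)[OF i] by simp
  have "x\<^sup>2 \<le> 1 + x ^ 4" for x :: real
  proof -
    have "2 * x\<^sup>2 \<le> x ^ 4 + 1" using zero_le_power2[of "x\<^sup>2 - 1"] by (simp add: power2_diff flip: power_mult)
    thus ?thesis using zero_le_power2[of x] by linarith
  qed
  hence *: "norm ((e i \<omega>)\<^sup>2) \<le> norm (1 + (e i \<omega>) ^ 4)" for \<omega>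
    by (simp add: abs_of_nonneg)
  show int2: "integrable M (\<lambda>\<omega>. (e i \<omega>)\<^sup>2)"
    by (rule Bochner_Integration.integrable_bound[OF int1 _ AE_I2[OF *]]) measurable
  have int3: "integrable M (\<lambda>\<omega>. 1 + (e i \<omega>)\<^sup>2)"
    using int2 by simp
  have "\<bar>x\<bar> \<le> 1 + x\<^sup>2" for x :: real
  proof -
    have "2 * \<bar>x\<bar> \<le> x\<^sup>2 + 1" using zero_le_power2[of "\<bar>x\<bar> - 1"] by (simp add: power2_diff)
    thus ?thesis using zero_le_power2[of x] by linarith
  qed
  hence **: "norm (e i \<omega>) \<le> norm (1 + (e i \<omega>)\<^sup>2)" for \<omega>
    by (simp add: abs_of_nonneg)
  have int: "integrable M (e i)"
    by (rule Bochner_Integration.integrable_bound[OF int3 _ AE_I2[OF **]]) measurable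
  show "variance (e i) \<le> expectation (\<lambda>\<omega>. (e i \<omega>)\<^sup>2)"
    using variance_eq[OF int int2] by simp
qed

text \<open>Since the squares are nonnegative, \<open>exp (- y)\<close> is bounded by its
  second-order Taylor polynomial, and a fourth moment controls the Laplace transform of each square.
  Independence and a Chernoff bound do the rest.\<close>

lemma norm_lower_tail:
  fixes \<sigma> \<eta> :: real
  assumes var: "\<And>i. i \<in> {1..n} \<Longrightarrow> variance (e i) = \<sigma>\<^sup>2" and "\<sigma> > 0" "\<eta> > 0"
  shows "prob {\<omega> \<in> space M. noise \<omega> \<bullet> noise \<omega> \<le> n * \<sigma>\<^sup>2 * (1 - \<eta>)}
      \<le> exp (- (n * \<eta>\<^sup>2) * (\<sigma> ^ 4 / (128 * b ^ 4)))"
proof -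
  \<comment> \<open>Minimiser of
    \<open>32 * t\<^sup>2 * b ^ 4 - t * \<sigma>\<^sup>2 * \<eta>\<close>, the exponent per
    observation.\<close>
  define t where "t = \<sigma>\<^sup>2 * \<eta> / (64 * b ^ 4)"
  have t: "t > 0" using assms b_pos by (simp add: t_def)
  have one: "(\<integral>\<^sup>+\<omega>. ennreal (exp (- t * (e i \<omega>)\<^sup>2)) \<partial>M) \<le> ennreal (exp (- t * \<sigma>\<^sup>2 + 32 * t\<^sup>2 * b ^ 4))"
    if i: "i \<in> {1..n}" for i
  proof -
    note [measurable] = measurable_e[OF i]
    note int = fourth_moment[OF i] second_moment[OF i]
    from exp_minus_le_quadratic[of "t * x\<^sup>2" for x] have *: "exp (- t * x\<^sup>2) \<le> 1 - t * x\<^sup>2 + t\<^sup>2 / 2 * x ^ 4" for x :: real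
      using t by (simp add: power_mult_distrib flip: power_mult)
    hence "(\<integral>\<^sup>+\<omega>. ennreal (exp (- t * (e i \<omega>)\<^sup>2)) \<partial>M)
        \<le> (\<integral>\<^sup>+\<omega>. ennreal (1 - t * (e i \<omega>)\<^sup>2 + t\<^sup>2 / 2 * (e i \<omega>) ^ 4) \<partial>M)"
      by (intro nn_integral_mono ennreal_leI) auto
    also have "\<dots> = ennreal (expectation (\<lambda>\<omega>. 1 - t * (e i \<omega>)\<^sup>2 + t\<^sup>2 / 2 * (e i \<omega>) ^ 4))"
      using int *[THEN order_trans[OF exp_ge_zero]] by (intro nn_integral_eq_integral) auto
    also have "expectation (\<lambda>\<omega>. 1 - t * (e i \<omega>)\<^sup>2 + t\<^sup>2 / 2 * (e i \<omega>) ^ 4)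
       = 1 - t * expectation (\<lambda>\<omega>. (e i \<omega>)\<^sup>2) + t\<^sup>2 / 2 * expectation (\<lambda>\<omega>. (e i \<omega>) ^ 4)"
      using int by (simp add: prob_space)
    also have "\<dots> \<le> 1 - t * \<sigma>\<^sup>2 + t\<^sup>2 / 2 * (64 * b ^ 4)"
      using int var[OF i] t by (intro add_mono diff_mono mult_left_mono) auto
    also have "\<dots> \<le> exp (- t * \<sigma>\<^sup>2 + 32 * t\<^sup>2 * b ^ 4)"
      using exp_ge_add_one_self[of "- t * \<sigma>\<^sup>2 + 32 * t\<^sup>2 * b ^ 4"] by (simp add: algebra_simps)
    finally show ?thesis by (simp add: ennreal_leI)
  qed
  have "emeasure M {\<omega> \<in> space M. noise \<omega> \<bullet> noise \<omega> \<le> n * \<sigma>\<^sup>2 * (1 - \<eta>)}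
     \<le> ennreal (exp (t * (n * \<sigma>\<^sup>2 * (1 - \<eta>)))) * (\<integral>\<^sup>+\<omega>\<in>space M. ennreal (exp (- t * (noise \<omega> \<bullet> noise \<omega>))) \<partial>M)"
    by (rule Chernoff_ineq_nn_integral_le[OF t]) auto
  also have "(\<integral>\<^sup>+\<omega>\<in>space M. ennreal (exp (- t * (noise \<omega> \<bullet> noise \<omega>))) \<partial>M)
     = (\<integral>\<^sup>+\<omega>. (\<Prod>i\<in>{1..n}. ennreal (exp (- t * (e i \<omega>)\<^sup>2))) \<partial>M)"
    unfolding noise_norm
    by (intro nn_integral_cong) (simp add: sum_distrib_left exp_sum prod_ennreal flip: sum_negf)
  also have "\<dots> = (\<Prod>i\<in>{1..n}. \<integral>\<^sup>+\<omega>. ennreal (exp (- t * (e i \<omega>)\<^sup>2)) \<partial>M)"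
    by (intro indep_vars_nn_integral indep_vars_compose2[OF indep]) auto
  also have "\<dots> \<le> (\<Prod>i\<in>{1..n}. ennreal (exp (- t * \<sigma>\<^sup>2 + 32 * t\<^sup>2 * b ^ 4)))"
    by (intro prod_mono_ennreal one)
  also have "\<dots> = ennreal (exp (n * (- t * \<sigma>\<^sup>2 + 32 * t\<^sup>2 * b ^ 4)))"
    by (simp add: exp_of_nat_mult ennreal_power)
  also have "ennreal (exp (t * (n * \<sigma>\<^sup>2 * (1 - \<eta>)))) * \<dots> = ennreal (exp (- (n * \<eta>\<^sup>2) * (\<sigma> ^ 4 / (128 * b ^ 4))))"
  proof -
    have "t * (n * \<sigma>\<^sup>2 * (1 - \<eta>)) + n * (- t * \<sigma>\<^sup>2 + 32 * t\<^sup>2 * b ^ 4) = - (n * \<eta>\<^sup>2) * (\<sigma> ^ 4 / (128 * b ^ 4))"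
    proof -
      define S where "S = \<sigma> ^ 4 / (128 * b ^ 4)"
      have "32 * t\<^sup>2 * b ^ 4 = \<eta>\<^sup>2 * S"
        using b_pos by (simp add: t_def S_def power2_eq_square power4_eq_xxxx field_simps)
      moreover have "t * \<sigma>\<^sup>2 * \<eta> = 2 * (\<eta>\<^sup>2 * S)"
        by (simp add: t_def S_def power2_eq_square power4_eq_xxxx mult_ac)
      moreover have "t * (n * \<sigma>\<^sup>2 * (1 - \<eta>)) + n * (- t * \<sigma>\<^sup>2 + 32 * t\<^sup>2 * b ^ 4)
          = n * (32 * t\<^sup>2 * b ^ 4 - t * \<sigma>\<^sup>2 * \<eta>)"
        by (simp add: algebra_simps)
      ultimately show ?thesis by (simp add: S_def)
    qed
    thus ?thesis by (simp add: ennreal_mult[symmetric] exp_add[symmetric])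
  qed
  finally show ?thesis by (simp add: emeasure_eq_measure mult_left_mono)
qed

end

subsection \<open>Residual sums of squares\<close>

abbreviation vspan :: "nat \<Rightarrow> real vec set \<Rightarrow> real vec set" where
  "vspan n S \<equiv> LinearCombinations.module.span class_ring (module_vec TYPE(real) n) S"

lemma scalar_prod_self_nonneg: "(v :: real vec) \<bullet> v \<ge> 0"
  by (simp add: scalar_prod_def sum_nonneg)

lemma scalar_prod_self_eq_0:
  fixes v :: "real vec"
  assumes "v \<in> carrier_vec n" "v \<bullet> v = 0"
  shows "v = 0\<^sub>v n"
proof -
  have "(\<Sum>i = 0..<n. v $ i * v $ i) = 0" using assms by (auto simp: scalar_prod_def)
  hence "\<forall>i\<in>{0..<n}. v $ i * v $ i = 0" by (subst (asm) sum_nonneg_eq_0_iff) auto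
  thus ?thesis using assms by (intro eq_vecI) auto
qed

lemma vspan_carrier: "S \<subseteq> carrier_vec n \<Longrightarrow> vspan n S \<subseteq> carrier_vec n"
proof -
  interpret vec_space "TYPE(real)" n .
  show "S \<subseteq> carrier_vec n \<Longrightarrow> ?thesis" using span_closed by auto
qed

lemma vspan_add:
  "S \<subseteq> carrier_vec n \<Longrightarrow> u \<in> vspan n S \<Longrightarrow> v \<in> vspan n S \<Longrightarrow> u + v \<in> vspan n S"
proof -
  interpret vec_space "TYPE(real)" n .
  show "S \<subseteq> carrier_vec n \<Longrightarrow> u \<in> vspan n S \<Longrightarrow> v \<in> vspan n S \<Longrightarrow> ?thesis" by (rule span_add1)
qed

lemma vspan_smult:
  "S \<subseteq> carrier_vec n \<Longrightarrow> u \<in> vspan n S \<Longrightarrow> c \<cdot>\<^sub>v u \<in> vspan n S"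
proof -
  interpret vec_space "TYPE(real)" n .
  show "S \<subseteq> carrier_vec n \<Longrightarrow> u \<in> vspan n S \<Longrightarrow> ?thesis" by (rule smult_in_span)
qed

lemma vspan_diff:
  assumes S: "S \<subseteq> carrier_vec n" and uv: "u \<in> vspan n S" "v \<in> vspan n S"
  shows "u - v \<in> vspan n S"
proof -
  have "u - v = u + (-1) \<cdot>\<^sub>v v" using vspan_carrier[OF S] uv by auto
  thus ?thesis using vspan_add[OF S uv(1) vspan_smult[OF S uv(2), of "-1"]] by simp
qed

lemma vspan_mono: "S \<subseteq> T \<Longrightarrow> vspan n S \<subseteq> vspan n T"
proof -
  interpret vec_space "TYPE(real)" n .
  show "S \<subseteq> T \<Longrightarrow> ?thesis" by (rule span_is_monotone)
qed

lemma vspan_superset: "S \<subseteq> carrier_vec n \<Longrightarrow> S \<subseteq> vspan n S"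
proof -
  interpret vec_space "TYPE(real)" n .
  show "S \<subseteq> carrier_vec n \<Longrightarrow> ?thesis" by (rule in_own_span)
qed

text \<open>The difference \<open>d\<close> of the two candidates lies in the span and is orthogonal
  to both residuals, hence to itself. Testing orthogonality on the generators suffices by
  linearity.\<close>

lemma is_orth_proj_eqI:
  assumes S: "S \<subseteq> carrier_vec n" and H: "is_orth_proj n (vspan n S) H"
    and y: "y \<in> carrier_vec n" and z: "z \<in> vspan n S" and orth: "\<And>w. w \<in> S \<Longrightarrow> w \<bullet> (y - z) = 0"
  shows "H *\<^sub>v y = z"
proof -
  have zc: "z \<in> carrier_vec n" using vspan_carrier[OF S] z by auto
  have Hc: "H \<in> carrier_mat n n" and Hy: "H *\<^sub>v y \<in> vspan n S" using H y by (auto simp: is_orth_proj_def)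
  have Hyc: "H *\<^sub>v y \<in> carrier_vec n" using Hc y by auto
  define d where "d = H *\<^sub>v y - z"
  have d: "d \<in> vspan n S" "d \<in> carrier_vec n"
    using vspan_diff[OF S Hy z] Hyc zc by (auto simp: d_def)
  have 1: "d \<bullet> (y - H *\<^sub>v y) = 0" using H y d by (auto simp: is_orth_proj_def)
  have 2: "d \<bullet> (y - z) = 0" by (rule lincomb_orthogonal[OF S _ orth d(1)]) (use y zc in auto)
  have "d \<bullet> d = d \<bullet> (H *\<^sub>v y) - d \<bullet> z"
    by (subst (2) d_def) (rule scalar_prod_minus_distrib[OF d(2) Hyc zc])
  also have "\<dots> = 0"
    using 1 2 scalar_prod_minus_distrib[OF d(2) y Hyc] scalar_prod_minus_distrib[OF d(2) y zc] by simp
  finally have "d = 0\<^sub>v n" using scalar_prod_self_eq_0 d by auto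
  show ?thesis
  proof (rule eq_vecI)
    fix i assume "i < dim_vec z"
    hence i: "i < n" using zc by simp
    have "d $ i = 0" using \<open>d = 0\<^sub>v n\<close> i by simp
    thus "(H *\<^sub>v y) $ i = z $ i" using i Hyc zc by (simp add: d_def)
  qed (use Hyc Hc zc in auto)
qed

text \<open>Gram-Schmidt, one vector at a time: the normalised residual of the new vector gives a
  rank-one update of the projection. Keeping \<open>us\<close> inside the span makes each new
  direction orthogonal to the earlier ones. Linear dependence only shortens \<open>us\<close>, hence
  the inequality for its length.\<close>

lemma orth_proj_extend:
  assumes "set (vs @ ws) \<subseteq> carrier_vec n" and H: "is_orth_proj n (vspan n (set ws)) H"
    and "is_orth_proj n (vspan n (set (vs @ ws))) G"
  shows "\<exists>us. orthonormal n us \<and> length us \<le> length vs \<and> set us \<subseteq> vspan n (set (vs @ ws)) \<and>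
     (\<forall>y\<in>carrier_vec n. y \<bullet> (G *\<^sub>v y) = y \<bullet> (H *\<^sub>v y) + (\<Sum>u\<leftarrow>us. (u \<bullet> y)\<^sup>2))"
  using assms(1,3)
proof (induction vs arbitrary: G)
  case Nil
  have "G = H"
    using Nil H vspan_carrier[of "set ws" n] vspan_diff[of "set ws" n]
    by (intro is_orth_proj_unique[of "vspan n (set ws)" n]) auto
  thus ?case by (intro exI[of _ "[]"]) auto
next
  case (Cons v vs)
  let ?S = "set (vs @ ws)" and ?S' = "set ((v # vs) @ ws)"
  have S': "?S' \<subseteq> carrier_vec n" and S: "?S \<subseteq> carrier_vec n" and v: "v \<in> carrier_vec n"
    using Cons.prems by auto
  obtain F where F: "is_orth_proj n (vspan n ?S) F" using is_orth_proj_exists[OF S] by blast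
  from Cons.IH[OF S F] obtain us where us: "orthonormal n us" "length us \<le> length vs"
      "set us \<subseteq> vspan n ?S" "\<And>y. y \<in> carrier_vec n \<Longrightarrow> y \<bullet> (F *\<^sub>v y) = y \<bullet> (H *\<^sub>v y) + (\<Sum>u\<leftarrow>us. (u \<bullet> y)\<^sup>2)"
    by blast
  have Fc: "F \<in> carrier_mat n n" using F by (auto simp: is_orth_proj_def)
  have Fy: "F *\<^sub>v y \<in> vspan n ?S" "F *\<^sub>v y \<in> carrier_vec n" "\<And>w. w \<in> vspan n ?S \<Longrightarrow> w \<bullet> (y - F *\<^sub>v y) = 0"
    if "y \<in> carrier_vec n" for y using that F Fc by (auto simp: is_orth_proj_def)
  have mono: "vspan n ?S \<subseteq> vspan n ?S'" by (rule vspan_mono) auto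
  have sup: "?S \<subseteq> vspan n ?S" "?S' \<subseteq> vspan n ?S'" by (rule vspan_superset[OF S] vspan_superset[OF S'])+
  define r where "r = v - F *\<^sub>v v"
  have r: "r \<in> carrier_vec n" using v Fy(2)[OF v] by (simp add: r_def)
  have vr: "v = r + F *\<^sub>v v" using v Fy(2)[OF v] Fc by (intro eq_vecI) (auto simp: r_def)
  show ?case
  proof (cases "r = 0\<^sub>v n")
    \<comment> \<open>The new vector already lies in the span, so the projection is unchanged and no
      direction is added.\<close>
    case True
    hence "v = F *\<^sub>v v" using vr Fy(2)[OF v] by simp
    hence vS: "v \<in> vspan n ?S" using Fy(1)[OF v] by simp
    have "G *\<^sub>v y = F *\<^sub>v y" if y: "y \<in> carrier_vec n" for y
    proof (rule is_orth_proj_eqI[OF S' Cons.prems(2) y])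
      show "F *\<^sub>v y \<in> vspan n ?S'" using Fy(1)[OF y] mono by blast
      show "w \<bullet> (y - F *\<^sub>v y) = 0" if "w \<in> ?S'" for w
        using that Fy(3)[OF y] vS sup by auto
    qed
    thus ?thesis using us mono by (intro exI[of _ us]) auto
  next
    case False
    hence rr: "r \<bullet> r > 0" using scalar_prod_self_eq_0[OF r] scalar_prod_self_nonneg[of r] by force
    define c where "c = 1 / sqrt (r \<bullet> r)"
    define u where "u = c \<cdot>\<^sub>v r"
    have u: "u \<in> carrier_vec n" using r by (simp add: u_def)
    have uu: "u \<bullet> u = 1" using r rr by (simp add: u_def c_def)
    have orth: "w \<bullet> u = 0" if "w \<in> vspan n ?S" for w
    proof -
      have "w \<in> carrier_vec n" using vspan_carrier[OF S] that by blast
      thus ?thesis using Fy(3)[OF v that] r by (simp add: u_def r_def[symmetric])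
    qed
    have rS': "r \<in> vspan n ?S'"
      unfolding r_def using sup(2) Fy(1)[OF v] mono by (intro vspan_diff[OF S']) auto
    hence uS': "u \<in> vspan n ?S'" unfolding u_def by (intro vspan_smult[OF S'])
    have ru: "r = sqrt (r \<bullet> r) \<cdot>\<^sub>v u"
      using r rr by (auto simp: u_def c_def smult_smult_assoc)
    \<comment> \<open>The candidate is recognised as the projection because its residual
      \<open>z\<close> is orthogonal to the old span, to \<open>u\<close>, and therefore to
      \<open>v\<close>, which is a multiple of \<open>u\<close> plus an element of the old
      span.\<close>
    have G: "G *\<^sub>v y = F *\<^sub>v y + (u \<bullet> y) \<cdot>\<^sub>v u" if y: "y \<in> carrier_vec n" for y
    proof (rule is_orth_proj_eqI[OF S' Cons.prems(2) y])
      show "F *\<^sub>v y + (u \<bullet> y) \<cdot>\<^sub>v u \<in> vspan n ?S'"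
        using Fy(1)[OF y] mono by (intro vspan_add[OF S'] vspan_smult[OF S'] uS') auto
      define z where "z = y - (F *\<^sub>v y + (u \<bullet> y) \<cdot>\<^sub>v u)"
      have z: "w \<bullet> z = w \<bullet> (y - F *\<^sub>v y) - (u \<bullet> y) * (w \<bullet> u)" if w: "w \<in> carrier_vec n" for w
      proof -
        have "z = (y - F *\<^sub>v y) - (u \<bullet> y) \<cdot>\<^sub>v u"
          using y u Fy(2)[OF y] Fc by (intro eq_vecI) (auto simp: z_def)
        thus ?thesis using w y u Fy(2)[OF y] by (simp add: scalar_prod_minus_distrib[of _ n])
      qed
      have zS: "w \<bullet> z = 0" if "w \<in> vspan n ?S" for w
        using z[of w] that vspan_carrier[OF S] Fy(3)[OF y that] orth[OF that] by auto
      have uF: "u \<bullet> (F *\<^sub>v y) = 0"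
        using orth[OF Fy(1)[OF y]] comm_scalar_prod[OF u Fy(2)[OF y]] by simp
      have uz: "u \<bullet> z = 0"
        using z[OF u] uu uF u y Fy(2)[OF y] by (simp add: scalar_prod_minus_distrib[of _ n])
      have zc: "z \<in> carrier_vec n" using y u Fy(2)[OF y] by (simp add: z_def)
      have "v \<bullet> z = sqrt (r \<bullet> r) * (u \<bullet> z) + (F *\<^sub>v v) \<bullet> z"
        by (subst vr, subst ru) (use u zc Fy(2)[OF v] in \<open>simp add: add_scalar_prod_distrib[of _ n]\<close>)
      hence "v \<bullet> z = 0" using uz zS[OF Fy(1)[OF v]] by simp
      thus "w \<bullet> (y - (F *\<^sub>v y + (u \<bullet> y) \<cdot>\<^sub>v u)) = 0" if "w \<in> ?S'" for w
        using that zS sup(1) unfolding z_def[symmetric] by auto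
    qed
    have quad: "y \<bullet> (G *\<^sub>v y) = y \<bullet> (H *\<^sub>v y) + (\<Sum>u\<leftarrow>u # us. (u \<bullet> y)\<^sup>2)" if y: "y \<in> carrier_vec n" for y
      using us(4)[OF y] y u Fy(2)[OF y] comm_scalar_prod[OF u y]
      by (simp add: G scalar_prod_add_distrib[of _ n] power2_eq_square)
    show ?thesis
      using us u uu orth uS' mono quad by (intro exI[of _ "u # us"]) auto
  qed
qed

section \<open>Hat matrices of nested models and the residual sum of squares\<close>

definition predictor :: "nat \<Rightarrow> (nat \<Rightarrow> nat \<Rightarrow> real) \<Rightarrow> nat \<Rightarrow> real vec" where
  "predictor n x j = vec n (\<lambda>i. x (Suc i) j)"

text \<open>A set, not a matrix: the projection depends only on the span, so the order and
  repetition of columns can be forgotten.\<close>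

definition columns :: "nat \<Rightarrow> (nat \<Rightarrow> nat \<Rightarrow> real) \<Rightarrow> nat set \<Rightarrow> real vec set" where
  "columns n x s = insert (vec n (\<lambda>_. 1)) (predictor n x ` s)"

lemma columns_carrier: "columns n x s \<subseteq> carrier_vec n"
  by (auto simp: columns_def predictor_def)

lemma col_space_design_mat:
  assumes "finite s"
  shows "vec_space.col_space n (design_mat n x s) = vspan n (columns n x s)"
proof -
  have *: "set (vec n (\<lambda>_. 1) # map (\<lambda>j. vec n (\<lambda>i. x (Suc i) j)) (sorted_list_of_set s)) = columns n x s"
    using assms by (simp add: columns_def predictor_def)
  hence "set (cols (design_mat n x s)) = columns n x s"
    unfolding design_mat_def using columns_carrier[of n x s] by (subst cols_mat_of_cols) auto
  thus ?thesis unfolding vec_space.col_space_def by simp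
qed

lemma hat_mat_orth_proj: "finite s \<Longrightarrow> is_orth_proj n (vspan n (columns n x s)) (hat_mat n x s)"
  using hat_mat_is_orth_proj[of n x s] col_space_design_mat[of s n x] by simp

lemma hat_mat_carrier [simp]: "hat_mat n x s \<in> carrier_mat n n"
  using hat_mat_is_orth_proj by (auto simp: is_orth_proj_def)

lemma hat_mat_fixes:
  assumes "finite s" "v \<in> vspan n (columns n x s)"
  shows "hat_mat n x s *\<^sub>v v = v"
  using assms vspan_carrier[OF columns_carrier, of n x s]
  by (intro is_orth_proj_eqI[OF columns_carrier hat_mat_orth_proj]) (auto dest!: subsetD[OF columns_carrier])

lemma hat_mat_quadratic_diff:
  assumes s: "finite s" "s\<^sub>0 \<subseteq> s"
  obtains us where "orthonormal n us" "length us \<le> card (s - s\<^sub>0)"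
    "\<And>y. y \<in> carrier_vec n \<Longrightarrow>
       y \<bullet> (hat_mat n x s *\<^sub>v y) = y \<bullet> (hat_mat n x s\<^sub>0 *\<^sub>v y) + (\<Sum>u\<leftarrow>us. (u \<bullet> y)\<^sup>2)"
proof -
  let ?vs = "map (predictor n x) (sorted_list_of_set (s - s\<^sub>0))"
  let ?ws = "vec n (\<lambda>_. 1) # map (predictor n x) (sorted_list_of_set s\<^sub>0)"
  have f: "finite s\<^sub>0" "finite (s - s\<^sub>0)" using s finite_subset by auto
  have 1: "set ?ws = columns n x s\<^sub>0" using f by (simp add: columns_def)
  have 2: "set (?vs @ ?ws) = columns n x s" using f s by (auto simp: columns_def)
  show ?thesis
    using orth_proj_extend[of ?vs ?ws n "hat_mat n x s\<^sub>0" "hat_mat n x s"] that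
    unfolding 1 2 using hat_mat_orth_proj f s columns_carrier by force
qed

lemma hat_mat_quadratic:
  assumes s: "finite s"
  obtains us where "orthonormal n us" "length us \<le> Suc (card s)"
    "\<And>y. y \<in> carrier_vec n \<Longrightarrow> y \<bullet> (hat_mat n x s *\<^sub>v y) = (\<Sum>u\<leftarrow>us. (u \<bullet> y)\<^sup>2)"
proof -
  interpret vec_space "TYPE(real)" n .
  let ?vs = "vec n (\<lambda>_. 1) # map (predictor n x) (sorted_list_of_set s)"
  \<comment> \<open>The extension starts from the zero space, so the intercept counts as one of the
    added columns; hence the \<open>Suc\<close> in the length bound.\<close>
  have 1: "is_orth_proj n (vspan n (set [])) (0\<^sub>m n n)"
  proof -
    have "0\<^sub>m n n *\<^sub>v y = 0\<^sub>v n" if "y \<in> carrier_vec n" for y :: "real vec"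
      using that by auto
    thus ?thesis unfolding is_orth_proj_def by (auto simp: span_empty)
  qed
  have 2: "set (?vs @ []) = columns n x s" using s by (simp add: columns_def)
  have 3: "length ?vs = Suc (card s)" by simp
  from orth_proj_extend[of ?vs "[]" n "0\<^sub>m n n" "hat_mat n x s", unfolded 2 3]
  obtain us where "orthonormal n us" "length us \<le> Suc (card s)"
    "\<And>y. y \<in> carrier_vec n \<Longrightarrow> y \<bullet> (hat_mat n x s *\<^sub>v y) = y \<bullet> (0\<^sub>m n n *\<^sub>v y) + (\<Sum>u\<leftarrow>us. (u \<bullet> y)\<^sup>2)"
    using 1 hat_mat_orth_proj[OF s] columns_carrier by blast
  moreover have "y \<bullet> (0\<^sub>m n n *\<^sub>v y) = 0" if "y \<in> carrier_vec n" for y :: "real vec"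
  proof -
    have "0\<^sub>m n n *\<^sub>v y = 0\<^sub>v n" using that by auto
    thus ?thesis using that by simp
  qed
  ultimately show ?thesis by (intro that) auto
qed

text \<open>The residual of \<open>m + y\<close> is the bias \<open>d\<close> plus the residual
  \<open>r\<close> of \<open>y\<close>. All cross terms reduce to \<open>d \<bullet> y\<close>
  because fitted vectors are orthogonal to residuals.\<close>

lemma RSS_add:
  fixes x :: "nat \<Rightarrow> nat \<Rightarrow> real"
  assumes s: "finite s" and m: "m \<in> carrier_vec n" and y: "y \<in> carrier_vec n"
  defines "d \<equiv> m - hat_mat n x s *\<^sub>v m"
  shows "RSS n x (m + y) s = d \<bullet> d + 2 * (d \<bullet> y) + y \<bullet> y - y \<bullet> (hat_mat n x s *\<^sub>v y)"
proof -
  let ?H = "hat_mat n x s"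
  have Hc: "?H *\<^sub>v v \<in> carrier_vec n" if "v \<in> carrier_vec n" for v
    using that hat_mat_carrier mult_mat_vec_carrier by blast
  have orth: "(?H *\<^sub>v u) \<bullet> (v - ?H *\<^sub>v v) = 0" if "u \<in> carrier_vec n" "v \<in> carrier_vec n" for u v
    using hat_mat_is_orth_proj[of n x s] that by (auto simp: is_orth_proj_def)
  define r where "r = y - ?H *\<^sub>v y"
  have d: "d \<in> carrier_vec n" and r: "r \<in> carrier_vec n"
    using m y Hc by (auto simp: d_def r_def)
  note Hm = Hc[OF m] and Hy = Hc[OF y]
  have "(1\<^sub>m n - ?H) *\<^sub>v (m + y) = d + r"
  proof -
    have "(1\<^sub>m n - ?H) *\<^sub>v (m + y) = (m + y) - ?H *\<^sub>v (m + y)"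
      using m y by (subst minus_mult_distrib_mat_vec[of _ n n]) auto
    also have "?H *\<^sub>v (m + y) = ?H *\<^sub>v m + ?H *\<^sub>v y"
      by (rule mult_add_distrib_mat_vec[OF hat_mat_carrier m y])
    also have "(m + y) - (?H *\<^sub>v m + ?H *\<^sub>v y) = d + r"
      unfolding d_def r_def using m y Hm Hy
      by (intro eq_vecI) (simp_all add: carrier_matD(1)[OF hat_mat_carrier])
    finally show ?thesis .
  qed
  hence "RSS n x (m + y) s = (m + y) \<bullet> (d + r)" by (simp add: RSS_def)
  also have "\<dots> = m \<bullet> d + m \<bullet> r + y \<bullet> d + y \<bullet> r"
    using m y d r by (simp add: add_scalar_prod_distrib[of _ n] scalar_prod_add_distrib[of _ n])
  also have "m \<bullet> d = d \<bullet> d"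
  proof -
    have "d \<bullet> d = m \<bullet> d - (?H *\<^sub>v m) \<bullet> d"
      by (subst (1) d_def, rule minus_scalar_prod_distrib[OF m Hm d])
    thus ?thesis using orth[OF m m] by (simp add: d_def)
  qed
  also have "m \<bullet> r = d \<bullet> y"
  proof -
    have "(?H *\<^sub>v y) \<bullet> d = 0" using orth[OF y m] by (simp add: d_def)
    hence "d \<bullet> (?H *\<^sub>v y) = 0" using comm_scalar_prod[OF Hy d] by simp
    hence "d \<bullet> r = d \<bullet> y" using d y Hy by (simp add: r_def scalar_prod_minus_distrib[of _ n])
    moreover have "d \<bullet> r = m \<bullet> r - (?H *\<^sub>v m) \<bullet> r"
      by (subst (1) d_def, rule minus_scalar_prod_distrib[OF m Hm r])
    ultimately show ?thesis using orth[OF m y] by (simp add: r_def)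
  qed
  also have "y \<bullet> d = d \<bullet> y" by (rule comm_scalar_prod[OF y d])
  also have "y \<bullet> r = y \<bullet> y - y \<bullet> (?H *\<^sub>v y)"
    using y Hy by (simp add: r_def scalar_prod_minus_distrib[of _ n])
  finally show ?thesis by simp
qed

section \<open>The mean vector and the decomposition of the response\<close>

lemma mean_vec_in_vspan:
  "mean_vec n p x \<beta> \<in> vspan n (columns n x (true_model p \<beta>))"
proof -
  interpret vec_space "TYPE(real)" n .
  let ?s = "true_model p \<beta>"
  have f: "finite ?s" by (simp add: true_model_def)
  have A: "design_mat n x ?s \<in> carrier_mat n (Suc (card ?s))"
    unfolding design_mat_def by (rule carrier_matI) simp_all
  have c: "coef_vec \<beta> ?s \<in> carrier_vec (Suc (card ?s))"
    unfolding coef_vec_def carrier_vec_def by simp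
  have "mean_vec n p x \<beta> \<in> col_space (design_mat n x ?s)"
    unfolding col_space_eq[OF A] mean_vec_def carrier_matD[OF A]
    using mult_mat_vec_carrier[OF A c] c by blast
  thus ?thesis by (simp add: col_space_design_mat[OF f])
qed

lemma mean_vec_carrier [simp]: "mean_vec n p x \<beta> \<in> carrier_vec n"
  using mean_vec_in_vspan vspan_carrier[OF columns_carrier] by blast

text \<open>Coefficients outside the true model vanish, so the sum over all predictors is the matrix
  product restricted to the true model.\<close>

lemma response_eq:
  "response n p x \<beta> f = mean_vec n p x \<beta> + vec n (\<lambda>i. f (Suc i))"
proof (rule eq_vecI)
  fix i assume "i < dim_vec (mean_vec n p x \<beta> + vec n (\<lambda>i. f (Suc i)))"
  hence i: "i < n" by simp
  let ?s = "true_model p \<beta>"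
  define js where "js = sorted_list_of_set ?s"
  have f: "finite ?s" by (simp add: true_model_def)
  have js: "distinct js" "set js = ?s" using f by (auto simp: js_def)
  have coef: "coef_vec \<beta> ?s $ k = (\<beta> 0 # map \<beta> js) ! k" "dim_vec (coef_vec \<beta> ?s) = Suc (length js)" for k
    unfolding coef_vec_def js_def[symmetric] by (rule vec_of_list_index) simp
  have "mean_vec n p x \<beta> $ i = (\<Sum>k = 0..<Suc (length js).
     (vec n (\<lambda>_. 1) # map (predictor n x) js) ! k $ i * (\<beta> 0 # map \<beta> js) ! k)"
  proof -
    have "mean_vec n p x \<beta> $ i = row (design_mat n x ?s) i \<bullet> coef_vec \<beta> ?s"
      using i unfolding mean_vec_def by (intro index_mult_mat_vec) (simp add: design_mat_def)
    also have "\<dots> = (\<Sum>k = 0..<Suc (length js). design_mat n x ?s $$ (i, k) * coef_vec \<beta> ?s $ k)"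
      unfolding scalar_prod_def coef(2)
      using i by (intro sum.cong refl) (auto simp: design_mat_def js_def[symmetric] simp del: upt_Suc)
    finally show ?thesis
      unfolding coef(1) using i
      by (auto intro!: sum.cong simp: design_mat_def mat_of_cols_index js_def[symmetric] predictor_def[abs_def]
            simp del: sum.op_ivl_Suc)
  qed
  \<comment> \<open>Index 0 of the column list is the intercept; splitting it off leaves the
    predictors.\<close>
  also have "\<dots> = \<beta> 0 + (\<Sum>k = 0..<length js. x (Suc i) (js ! k) * \<beta> (js ! k))"
    unfolding sum.atLeast0_lessThan_Suc_shift using i by (simp add: predictor_def)
  also have "(\<Sum>k = 0..<length js. x (Suc i) (js ! k) * \<beta> (js ! k)) = (\<Sum>j\<in>?s. x (Suc i) j * \<beta> j)"
    using sum_list_distinct_conv_sum_set[OF js(1), of "\<lambda>j. x (Suc i) j * \<beta> j"] js(2)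
    by (simp add: sum_list_sum_nth)
  also have "\<dots> = (\<Sum>j = 1..p. \<beta> j * x (Suc i) j)"
    by (rule sum.mono_neutral_cong_left) (auto simp: true_model_def)
  finally show "response n p x \<beta> f $ i = (mean_vec n p x \<beta> + vec n (\<lambda>i. f (Suc i))) $ i"
    using i by (simp add: response_def)
qed (simp add: response_def)

subsection \<open>A finite-sample bound\<close>

lemma sum_power_card_Pow:
  fixes q :: real
  assumes "finite A"
  shows "(\<Sum>s\<in>Pow A. q ^ card s) = (1 + q) ^ card A"
proof -
  have "(\<Sum>s\<in>Pow A. q ^ card s) = (\<Sum>s\<in>Pow A. (\<Prod>i\<in>s. q) * (\<Prod>i\<in>A - s. 1))"
    by simp
  also have "\<dots> = (\<Prod>i\<in>A. q + 1)" by (rule prod_add[OF assms, symmetric])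
  finally show ?thesis by (simp add: add.commute)
qed

lemma one_add_power_le_exp:
  fixes q :: real
  assumes "q \<ge> 0"
  shows "(1 + q) ^ m \<le> exp (q * m)"
proof -
  have "(1 + q) ^ m \<le> exp q ^ m" using assms by (intro power_mono) auto
  thus ?thesis by (simp add: exp_of_nat_mult[symmetric] mult.commute)
qed

text \<open>Removing \<open>s\<^sub>0\<close> maps the strict supersets to the nonempty subsets of
  \<open>A - s\<^sub>0\<close>. The missing empty set accounts for the \<open>- 1\<close>, which
  makes the bound vanish as \<open>q * card A\<close> tends to 0.\<close>

lemma sum_power_card_supersets:
  fixes q :: real
  assumes A: "finite A" "s\<^sub>0 \<subseteq> A" and q: "q \<ge> 0"
  shows "(\<Sum>s | s \<subseteq> A \<and> s\<^sub>0 \<subset> s. q ^ card (s - s\<^sub>0)) \<le> exp (q * card A) - 1"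
proof -
  have fin: "finite (A - s\<^sub>0)" using A by auto
  have "(\<Sum>s | s \<subseteq> A \<and> s\<^sub>0 \<subset> s. q ^ card (s - s\<^sub>0)) = (\<Sum>s\<in>Pow (A - s\<^sub>0) - {{}}. q ^ card s)"
    using A by (intro sum.reindex_bij_witness[of _ "\<lambda>s. s \<union> s\<^sub>0" "\<lambda>s. s - s\<^sub>0"]) auto
  also have "\<dots> = (1 + q) ^ card (A - s\<^sub>0) - 1"
    using fin by (subst sum_diff1) (auto simp: sum_power_card_Pow)
  also have "(1 + q) ^ card (A - s\<^sub>0) \<le> (1 + q) ^ card A"
    using A q by (intro power_increasing card_mono) auto
  also have "\<dots> \<le> exp (q * card A)" by (rule one_add_power_le_exp[OF q])
  finally show ?thesis by simp
qed

text \<open>Each set of size at most \<open>K\<close> gets the weight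
  \<open>P powr (K - card s)\<close>, which is at least 1. Extending the weighted sum to all subsets
  gives \<open>(1 + 1 / P) ^ P * P powr K\<close>, and the first factor is at most
  \<open>exp 1\<close>.\<close>

lemma card_small_subsets:
  assumes A: "finite A" "A \<noteq> {}"
  shows "real (card {s. s \<subseteq> A \<and> real (card s) \<le> K}) \<le> exp 1 * real (card A) powr K"
proof -
  define P where "P = real (card A)"
  have P: "P \<ge> 1" using A by (simp add: P_def Suc_le_eq card_gt_0_iff)
  have "real (card {s. s \<subseteq> A \<and> real (card s) \<le> K}) = (\<Sum>s | s \<subseteq> A \<and> real (card s) \<le> K. 1)"
    by simp
  also have "\<dots> \<le> (\<Sum>s | s \<subseteq> A \<and> real (card s) \<le> K. (1 / P) ^ card s * P powr K)"
  proof (rule sum_mono)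
    fix s assume "s \<in> {s. s \<subseteq> A \<and> real (card s) \<le> K}"
    hence "1 \<le> P powr (K - card s)" using P by (intro ge_one_powr_ge_zero) auto
    also have "P powr (K - card s) = (1 / P) ^ card s * P powr K"
      using P by (simp add: powr_diff powr_realpow power_divide)
    finally show "1 \<le> (1 / P) ^ card s * P powr K" .
  qed
  also have "\<dots> \<le> (\<Sum>s\<in>Pow A. (1 / P) ^ card s * P powr K)"
    using A P by (intro sum_mono2) auto
  also have "\<dots> = (1 + 1 / P) ^ card A * P powr K"
    using A by (simp add: sum_power_card_Pow flip: sum_distrib_right)
  also have "\<dots> \<le> exp (1 / P * card A) * P powr K"
    using P by (intro mult_right_mono one_add_power_le_exp) auto
  also have "1 / P * card A = 1" using P by (simp add: P_def)
  finally show ?thesis by (simp add: P_def)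
qed

section \<open>Deterministic comparison of criterion values\<close>

lemma mBIC_less_iff:
  assumes "n > 0" "RSS n x y s\<^sub>0 > 0" "RSS n x y s > 0"
  shows "mBIC \<gamma> n p x y s\<^sub>0 < mBIC \<gamma> n p x y s \<longleftrightarrow>
     (real (card s\<^sub>0) - card s) * (ln n + 2 * \<gamma> * ln p) < n * ln (RSS n x y s / RSS n x y s\<^sub>0)"
  using assms by (simp add: mBIC_def ext_ln_def ln_div algebra_simps)

lemma mBIC_overfit_aux:
  fixes R\<^sub>0 d A \<sigma> \<eta> \<rho> :: real and n m :: nat
  assumes n: "n > 0" and A: "A \<ge> 0" and \<sigma>: "\<sigma> > 0"
    and R0: "R\<^sub>0 \<ge> n * \<sigma>\<^sup>2 * (1 - \<eta> - \<rho>)" "R\<^sub>0 > 0"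
    and small: "\<rho> \<ge> 0" "\<rho> + m * A / (2 * n) \<le> \<eta>" "\<eta> < 1 / 2"
    and d: "d < m * (\<sigma>\<^sup>2 * (1 - 2 * \<eta>) * A)"
  shows "R\<^sub>0 - d > 0" "- (real m * A) < n * ln ((R\<^sub>0 - d) / R\<^sub>0)"
proof -
  define u where "u = m * A / n"
  have u: "u \<ge> 0" "u / 2 \<le> \<eta> - \<rho>" using A n small by (auto simp: u_def field_simps)
  have "u * (1 - u / 2) \<le> 1 - exp (- u)"
    using exp_minus_le_quadratic[OF u(1)] by (simp add: power2_eq_square algebra_simps)
  have "d < m * (\<sigma>\<^sup>2 * (1 - 2 * \<eta>) * A)" by (rule d)
  also have "\<dots> = n * \<sigma>\<^sup>2 * u * (1 - 2 * \<eta>)" using n by (simp add: u_def field_simps)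
  also have "\<dots> \<le> n * \<sigma>\<^sup>2 * u * ((1 - \<eta> - \<rho>) * (1 - u / 2))"
  proof (intro mult_left_mono)
    \<comment> \<open>Dropping this nonnegative product leaves
      \<open>1 - \<eta> - \<rho> - u / 2\<close>, which is at least \<open>1 - 2 * \<eta>\<close>
      because \<rho> and \<open>u / 2\<close> together fit into \<eta>.\<close>
    have "(\<eta> + \<rho>) * (u / 2) \<ge> 0" using u small by (intro mult_nonneg_nonneg) auto
    moreover have expand: "(1 - \<eta> - \<rho>) * (1 - v) = 1 - \<eta> - \<rho> - v + (\<eta> + \<rho>) * v" for v
      by (simp add: algebra_simps)
    ultimately show "1 - 2 * \<eta> \<le> (1 - \<eta> - \<rho>) * (1 - u / 2)"
      unfolding expand using u by linarith
  qed (use u in auto)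
  also have "\<dots> = n * \<sigma>\<^sup>2 * (1 - \<eta> - \<rho>) * (u * (1 - u / 2))" by (simp add: mult_ac)
  also have "\<dots> \<le> R\<^sub>0 * (u * (1 - u / 2))"
    using R0 u small by (intro mult_right_mono mult_nonneg_nonneg) auto
  also have "\<dots> \<le> R\<^sub>0 * (1 - exp (- u))"
    using R0 by (intro mult_left_mono) (use \<open>u * (1 - u / 2) \<le> 1 - exp (- u)\<close> in auto)
  finally have *: "R\<^sub>0 * exp (- u) < R\<^sub>0 - d" by (simp add: algebra_simps)
  moreover have "0 < R\<^sub>0 * exp (- u)" using R0 by simp
  ultimately show pos: "R\<^sub>0 - d > 0" by linarith
  have "exp (- u) < (R\<^sub>0 - d) / R\<^sub>0" using * R0 by (simp add: field_simps)
  hence "ln (exp (- u)) < ln ((R\<^sub>0 - d) / R\<^sub>0)" by (intro ln_strict_mono) auto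
  hence "- u < ln ((R\<^sub>0 - d) / R\<^sub>0)" by simp
  hence "n * (- u) < n * ln ((R\<^sub>0 - d) / R\<^sub>0)" using n by (intro mult_strict_left_mono) auto
  thus "- (real m * A) < n * ln ((R\<^sub>0 - d) / R\<^sub>0)" using n by (simp add: u_def)
qed

text \<open>The increment is at least \<open>z * R\<^sub>0\<close> with
  \<open>z = 4 * D / n\<close>, because \<open>R\<^sub>0\<close> is at most
  \<open>4 * b\<^sup>2 * n\<close>. As \<open>z \<le> 1 / 2\<close>, the logarithm of
  \<open>1 + z\<close> is at least \<open>z / 2\<close>, which gives \<open>2 * D\<close> after
  multiplication by \<open>n\<close>.\<close>

lemma mBIC_underfit_aux:
  fixes R R\<^sub>0 b D :: real and n :: nat
  assumes n: "n > 0" and b: "b > 0"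
    and R: "0 < R\<^sub>0" "R\<^sub>0 \<le> 4 * b\<^sup>2 * n" "R \<ge> R\<^sub>0 + 16 * b\<^sup>2 * D"
    and D: "0 < D" "8 * D \<le> n"
  shows "2 * D \<le> n * ln (R / R\<^sub>0)"
proof -
  define z where "z = 4 * D / n"
  have z: "z > 0" "z \<le> 1 / 2" using D n by (auto simp: z_def field_simps)
  have "z * R\<^sub>0 \<le> z * (4 * b\<^sup>2 * n)" using R z by (intro mult_left_mono) auto
  also have "\<dots> = 16 * b\<^sup>2 * D" using n by (simp add: z_def)
  finally have "(1 + z) * R\<^sub>0 \<le> R" using R by (simp add: algebra_simps)
  hence 1: "1 + z \<le> R / R\<^sub>0" using R by (simp add: field_simps)
  have "z * z \<le> z * (1 / 2)" using z by (intro mult_left_mono) auto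
  hence "z / 2 \<le> z - z\<^sup>2" by (simp add: power2_eq_square)
  also have "\<dots> \<le> ln (1 + z)" using z by (intro ln_one_plus_pos_lower_bound) auto
  also have "\<dots> \<le> ln (R / R\<^sub>0)" using 1 z by (intro ln_mono) auto
  finally have "n * (z / 2) \<le> n * ln (R / R\<^sub>0)" by (intro mult_left_mono) auto
  thus ?thesis using n by (simp add: z_def)
qed

section \<open>Probabilities of the bad events\<close>

context subgaussian_noise
begin

text \<open>The squared length of the noise component that the model fits.\<close>

definition hat_form :: "(nat \<Rightarrow> nat \<Rightarrow> real) \<Rightarrow> nat set \<Rightarrow> 'a \<Rightarrow> real" where
  "hat_form x s \<omega> = noise \<omega> \<bullet> (hat_mat n x s *\<^sub>v noise \<omega>)"

text \<open>The part of the mean outside the column space of the model; its squared length is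
  \<open>Delta\<close>.\<close>

definition bias :: "nat \<Rightarrow> (nat \<Rightarrow> nat \<Rightarrow> real) \<Rightarrow> (nat \<Rightarrow> real) \<Rightarrow> nat set \<Rightarrow> real vec" where
  "bias p x \<beta> s = mean_vec n p x \<beta> - hat_mat n x s *\<^sub>v mean_vec n p x \<beta>"

lemma bias_carrier [simp]: "bias p x \<beta> s \<in> carrier_vec n"
  unfolding bias_def by (intro minus_carrier_vec mult_mat_vec_carrier[OF hat_mat_carrier]) auto

lemma Delta_eq: "Delta n p x \<beta> s = bias p x \<beta> s \<bullet> bias p x \<beta> s"
  by (simp add: Delta_def euclid_norm_def bias_def[symmetric] scalar_prod_self_nonneg)

lemma bias_eq_0:
  assumes "finite s" "true_model p \<beta> \<subseteq> s"
  shows "bias p x \<beta> s = 0\<^sub>v n"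
proof -
  have "mean_vec n p x \<beta> \<in> vspan n (columns n x s)"
    using mean_vec_in_vspan[of n p x \<beta>] vspan_mono[of "columns n x (true_model p \<beta>)" "columns n x s" n] assms
    by (auto simp: columns_def)
  thus ?thesis unfolding bias_def by (simp add: hat_mat_fixes[OF assms(1)])
qed

lemma response_noise: "response n p x \<beta> (\<lambda>i. e i \<omega>) = mean_vec n p x \<beta> + noise \<omega>"
  unfolding response_eq noise_def ..

lemma RSS_response:
  assumes "finite s"
  shows "RSS n x (response n p x \<beta> (\<lambda>i. e i \<omega>)) s =
     Delta n p x \<beta> s + 2 * (bias p x \<beta> s \<bullet> noise \<omega>) + noise \<omega> \<bullet> noise \<omega> - hat_form x s \<omega>"
  unfolding response_noise Delta_eq hat_form_def bias_def
  by (rule RSS_add[OF assms mean_vec_carrier noise_carrier])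

lemma hat_form_nonneg: "finite s \<Longrightarrow> hat_form x s \<omega> \<ge> 0"
  unfolding hat_form_def
  by (rule hat_mat_quadratic[of s n x]) (auto intro!: sum_list_nonneg)

lemma measurable_hat_form [measurable]:
  assumes "finite s"
  shows "hat_form x s \<in> borel_measurable M"
proof -
  obtain us where us: "\<And>y. y \<in> carrier_vec n \<Longrightarrow> y \<bullet> (hat_mat n x s *\<^sub>v y) = (\<Sum>u\<leftarrow>us. (u \<bullet> y)\<^sup>2)"
    using hat_mat_quadratic[OF assms, of n x] by metis
  have "hat_form x s = (\<lambda>\<omega>. \<Sum>u\<leftarrow>us. (u \<bullet> noise \<omega>)\<^sup>2)" by (auto simp: hat_form_def us)
  thus ?thesis by simp
qed

lemma hat_form_tail:
  assumes s: "finite s" and m: "Suc (card s) \<le> m"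
  shows "prob {\<omega> \<in> space M. t \<le> hat_form x s \<omega>} \<le> exp (- t / (4 * b\<^sup>2)) * sqrt 2 ^ m"
proof -
  obtain us where us: "orthonormal n us" "length us \<le> Suc (card s)"
      "\<And>y. y \<in> carrier_vec n \<Longrightarrow> y \<bullet> (hat_mat n x s *\<^sub>v y) = (\<Sum>u\<leftarrow>us. (u \<bullet> y)\<^sup>2)"
    using hat_mat_quadratic[OF s] by metis
  show ?thesis
    using quadratic_tail[OF us(1) order_trans[OF us(2) m], of 2 t] by (simp add: hat_form_def us(3))
qed

lemma hat_form_diff_tail:
  fixes t L :: real
  assumes s: "finite s" "s\<^sub>0 \<subseteq> s" and L: "L > 1"
  shows "prob {\<omega> \<in> space M. card (s - s\<^sub>0) * t \<le> hat_form x s \<omega> - hat_form x s\<^sub>0 \<omega>}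
    \<le> (exp (- ((1 - 1 / L) / (2 * b\<^sup>2)) * t) * sqrt L) ^ card (s - s\<^sub>0)"
proof -
  obtain us where us: "orthonormal n us" "length us \<le> card (s - s\<^sub>0)"
      "\<And>y. y \<in> carrier_vec n \<Longrightarrow>
       y \<bullet> (hat_mat n x s *\<^sub>v y) = y \<bullet> (hat_mat n x s\<^sub>0 *\<^sub>v y) + (\<Sum>u\<leftarrow>us. (u \<bullet> y)\<^sup>2)"
    using hat_mat_quadratic_diff[OF s] by metis
  have "exp (- ((1 - 1 / L) / (2 * b\<^sup>2)) * (card (s - s\<^sub>0) * t)) =
        exp (- ((1 - 1 / L) / (2 * b\<^sup>2)) * t) ^ card (s - s\<^sub>0)"
    by (subst exp_of_nat_mult[symmetric]) (simp add: mult_ac)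
  thus ?thesis
    using quadratic_tail[OF us(1,2) L, of "card (s - s\<^sub>0) * t"]
    by (simp add: hat_form_def us(3) power_mult_distrib)
qed

lemma measurable_mBIC [measurable]:
  assumes "finite s"
  shows "(\<lambda>\<omega>. mBIC \<gamma> n p x (response n p x \<beta> (\<lambda>i. e i \<omega>)) s) \<in> borel_measurable M"
  using assms unfolding mBIC_def ext_ln_def RSS_response[OF assms] by measurable

lemma overfit_tail:
  fixes t L q :: real
  assumes A: "finite A" "s\<^sub>0 \<subseteq> A" and L: "L > 1"
  defines "q \<equiv> exp (- ((1 - 1 / L) / (2 * b\<^sup>2)) * t) * sqrt L"
  shows "prob (\<Union>s\<in>{s. s \<subseteq> A \<and> s\<^sub>0 \<subset> s}.
      {\<omega> \<in> space M. card (s - s\<^sub>0) * t \<le> hat_form x s \<omega> - hat_form x s\<^sub>0 \<omega>}) \<le> exp (q * card A) - 1"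
    (is "prob (\<Union>s\<in>?S. ?B s) \<le> _")
proof -
  have fin: "finite ?S" by (rule finite_subset[of _ "Pow A"]) (use A in auto)
  have s: "finite s" "finite s\<^sub>0" "s\<^sub>0 \<subseteq> s" if "s \<in> ?S" for s
    using that A finite_subset by auto
  have "?B s \<in> events" if "s \<in> ?S" for s using s[OF that] by measurable
  hence "prob (\<Union>s\<in>?S. ?B s) \<le> (\<Sum>s\<in>?S. prob (?B s))"
    using fin by (intro finite_measure_subadditive_finite) auto
  also have "\<dots> \<le> (\<Sum>s\<in>?S. q ^ card (s - s\<^sub>0))"
    unfolding q_def using hat_form_diff_tail[OF s(1,3) L] by (intro sum_mono) auto
  also have "\<dots> \<le> exp (q * card A) - 1"
    using L by (intro sum_power_card_supersets A) (simp add: q_def)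
  finally show ?thesis .
qed

text \<open>There are at most \<open>exp 1 * p powr (k * p\<^sub>0)\<close> candidates, and each of
  the two events has probability at most \<open>p powr (- (k + 1) * p\<^sub>0)\<close>. The union
  bound leaves \<open>p powr (- p\<^sub>0)\<close>, up to the factor
  \<open>2 * exp 1\<close>.\<close>

lemma underfit_tail:
  fixes k :: real and p p\<^sub>0 :: nat
  assumes p: "p \<ge> 2" and p0: "p\<^sub>0 \<ge> 1" and k: "k > 1"
    and S: "S \<subseteq> {s. s \<subseteq> {1..p} \<and> real (card s) \<le> k * p\<^sub>0}"
    and Delta: "\<And>s. s \<in> S \<Longrightarrow> Delta n p x \<beta> s \<ge> 128 * b\<^sup>2 * (k + 1) * (p\<^sub>0 * ln p)"
  shows "prob (\<Union>s\<in>S.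
      {\<omega> \<in> space M. bias p x \<beta> s \<bullet> noise \<omega> \<le> - Delta n p x \<beta> s / 8} \<union>
      {\<omega> \<in> space M. Delta n p x \<beta> s / 4 \<le> hat_form x s \<omega>}) \<le> 2 * exp 1 / p"
    (is "prob (\<Union>s\<in>S. ?B s \<union> ?C s) \<le> _")
proof -
  define a where "a = (k + 1) * p\<^sub>0"
  have finS: "finite {s. s \<subseteq> {1..p} \<and> real (card s) \<le> k * p\<^sub>0}"
    by (rule finite_subset[of _ "Pow {1..p}"]) auto
  have fin: "finite S" by (rule finite_subset[OF S finS])
  have s: "finite s" "real (card s) \<le> k * p\<^sub>0" if "s \<in> S" for s
    using that S finite_subset[of s "{1..p}"] by auto
  have lnp: "ln p > 0" using p by simp
  have B: "prob (?B s) \<le> p powr (- a)" if "s \<in> S" for s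
  proof -
    have "prob (?B s) \<le> exp (- Delta n p x \<beta> s / (128 * b\<^sup>2))"
      unfolding Delta_eq by (rule linear_tail) simp
    also have "\<dots> \<le> exp (- a * ln p)"
      using Delta[OF that] b_pos by (simp add: a_def field_simps)
    also have "\<dots> = p powr (- a)" using p by (simp add: powr_def)
    finally show ?thesis .
  qed
  have C: "prob (?C s) \<le> p powr (- a)" if sS: "s \<in> S" for s
  proof -
    \<comment> \<open>Needed to absorb the intercept: half of \<open>Suc (card s)\<close> is then at
      most \<open>k * p\<^sub>0\<close>.\<close>
    have kp: "1 \<le> k * p\<^sub>0" using k p0 mult_mono[of 1 k 1 "real p\<^sub>0"] by simp
    have "sqrt 2 ^ m = 2 powr (m / 2)" for m
      by (simp add: powr_half_sqrt[symmetric] powr_powr flip: powr_realpow)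
    hence "sqrt 2 ^ Suc (card s) = 2 powr (Suc (card s) / 2)" .
    also have "\<dots> \<le> 2 powr (k * p\<^sub>0)" using s(2)[OF sS] kp by (intro powr_mono) auto
    also have "\<dots> \<le> p powr (k * p\<^sub>0)" using p kp by (intro powr_mono2) auto
    finally have 1: "sqrt 2 ^ Suc (card s) \<le> p powr (k * p\<^sub>0)" .
    \<comment> \<open>Twice the exponent \<open>a\<close> is extracted from \<open>Delta\<close>;
      one copy pays for the factor \<open>sqrt 2 ^ Suc (card s)\<close>.\<close>
    have "exp (- (Delta n p x \<beta> s / 4) / (4 * b\<^sup>2)) \<le> exp (- (2 * a) * ln p)"
    proof -
      have "2 * a * ln p * (16 * b\<^sup>2) \<le> 128 * b\<^sup>2 * (k + 1) * (p\<^sub>0 * ln p)"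
        using k lnp by (simp add: a_def)
      also have "\<dots> \<le> Delta n p x \<beta> s" by (rule Delta[OF sS])
      finally show ?thesis using b_pos by (simp add: field_simps)
    qed
    also have "\<dots> = p powr (- (2 * a))" using p by (simp add: powr_def)
    finally have 2: "exp (- (Delta n p x \<beta> s / 4) / (4 * b\<^sup>2)) \<le> p powr (- (2 * a))" .
    have "prob (?C s) \<le> exp (- (Delta n p x \<beta> s / 4) / (4 * b\<^sup>2)) * sqrt 2 ^ Suc (card s)"
      by (rule hat_form_tail) (use s[OF sS] in auto)
    also have "\<dots> \<le> p powr (- (2 * a)) * p powr (k * p\<^sub>0)"
      by (intro mult_mono 1 2) auto
    also have "\<dots> = p powr (k * p\<^sub>0 - 2 * a)" by (simp add: powr_add[symmetric])
    also have "\<dots> \<le> p powr (- a)" using p by (intro powr_mono) (auto simp: a_def algebra_simps)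
    finally show ?thesis .
  qed
  have meas: "?B s \<in> events" "?C s \<in> events" if "s \<in> S" for s using s[OF that] by measurable
  have "prob (\<Union>s\<in>S. ?B s \<union> ?C s) \<le> (\<Sum>s\<in>S. prob (?B s \<union> ?C s))"
    using meas fin by (intro finite_measure_subadditive_finite) auto
  also have "\<dots> \<le> (\<Sum>s\<in>S. 2 * p powr (- a))"
  proof (rule sum_mono)
    fix s assume "s \<in> S"
    thus "prob (?B s \<union> ?C s) \<le> 2 * p powr (- a)"
      using measure_Un_le[OF meas(1)[of s] meas(2)[of s]] B[of s] C[of s] by linarith
  qed
  also have "\<dots> = card S * (2 * p powr (- a))" by simp
  also have "real (card S) \<le> real (card {s. s \<subseteq> {1..p} \<and> real (card s) \<le> k * p\<^sub>0})"
    using card_mono[OF finS S] by simp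
  also have "\<dots> \<le> exp 1 * p powr (k * p\<^sub>0)"
    using card_small_subsets[of "{1..p}" "k * p\<^sub>0"] p by simp
  also have "exp 1 * p powr (k * p\<^sub>0) * (2 * p powr (- a)) = 2 * exp 1 * p powr (- real p\<^sub>0)"
    by (simp add: powr_add[symmetric] a_def algebra_simps)
  also have "p powr (- real p\<^sub>0) \<le> p powr (- 1)" using p p0 by (intro powr_mono) auto
  also have "2 * exp 1 * p powr (- 1) = 2 * exp 1 / p" using p by (simp add: powr_minus field_simps)
  finally show ?thesis by (simp add: mult_right_mono)
qed

text \<open>The threshold yields \<open>(sqrt 2 / p) ^ Suc (card s)\<close>; the base is at most 1,
  so a single factor may be kept.\<close>

lemma true_model_tail:
  assumes s: "finite s" and p: "p \<ge> (2 :: nat)"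
  shows "prob {\<omega> \<in> space M. 4 * b\<^sup>2 * (real (Suc (card s)) * ln p) \<le> hat_form x s \<omega>} \<le> sqrt 2 / p"
proof -
  let ?m = "Suc (card s)"
  have "exp (- (4 * b\<^sup>2 * (real ?m * ln p)) / (4 * b\<^sup>2)) = exp (real ?m * (- ln p))"
    using b_pos by simp
  also have "\<dots> = (1 / p) ^ ?m" unfolding exp_of_nat_mult using p by (simp add: exp_minus inverse_eq_divide)
  finally have "exp (- (4 * b\<^sup>2 * (real ?m * ln p)) / (4 * b\<^sup>2)) * sqrt 2 ^ ?m = (sqrt 2 / p) ^ ?m"
    by (simp add: power_divide)
  also have "\<dots> \<le> (sqrt 2 / p) ^ 1"
  proof (rule power_decreasing)
    have "sqrt 2 \<le> sqrt 4" by (intro real_sqrt_le_mono) simp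
    thus "sqrt 2 / p \<le> 1" using p by simp
  qed auto
  finally show ?thesis using hat_form_tail[OF s order_refl, of "4 * b\<^sup>2 * (real ?m * ln p)" x] by simp
qed


text \<open>Purely deterministic: outside the bad events a fixed competitor loses. A superset of
  \<open>s\<^sub>0\<close> has no bias and its gain in fit is below its penalty. Any other model has
  a bias that outweighs its noise terms and all savings in penalty.\<close>

lemma mBIC_good_event:
  fixes k \<gamma> \<eta> \<sigma> A D :: real and p :: nat and x :: "nat \<Rightarrow> nat \<Rightarrow> real" and \<beta> :: "nat \<Rightarrow> real"
  defines "s\<^sub>0 \<equiv> true_model p \<beta>"
  defines "A \<equiv> ln n + 2 * \<gamma> * ln p"
  defines "D \<equiv> real (card s\<^sub>0) * ln p"
  assumes n: "n \<ge> 2" and p: "p \<ge> n" and p0: "card s\<^sub>0 \<ge> 1" and g: "\<gamma> \<ge> 0" and sigma: "\<sigma> > 0"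
    and eta: "\<eta> < 1 / 2"
    and small: "8 * b\<^sup>2 * D / (n * \<sigma>\<^sup>2) + k * card s\<^sub>0 * A / (2 * n) \<le> \<eta>" "8 * ((1 + \<gamma>) * D) \<le> n"
    and lower: "n * \<sigma>\<^sup>2 * (1 - \<eta>) < noise \<omega> \<bullet> noise \<omega>"
    and upper: "noise \<omega> \<bullet> noise \<omega> < 4 * b\<^sup>2 * n"
    and H0: "hat_form x s\<^sub>0 \<omega> < 4 * b\<^sup>2 * (real (Suc (card s\<^sub>0)) * ln p)"
    and s: "s \<subseteq> {1..p}" "s \<noteq> s\<^sub>0" "real (card s) \<le> k * card s\<^sub>0"
    and over: "s\<^sub>0 \<subset> s \<Longrightarrow> hat_form x s \<omega> - hat_form x s\<^sub>0 \<omega> < card (s - s\<^sub>0) * (\<sigma>\<^sup>2 * (1 - 2 * \<eta>) * A)"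
    and under: "\<not> s\<^sub>0 \<subseteq> s \<Longrightarrow> 32 * b\<^sup>2 * ((1 + \<gamma>) * D) \<le> Delta n p x \<beta> s"
      "\<not> s\<^sub>0 \<subseteq> s \<Longrightarrow> - Delta n p x \<beta> s / 8 < bias p x \<beta> s \<bullet> noise \<omega>"
      "\<not> s\<^sub>0 \<subseteq> s \<Longrightarrow> hat_form x s \<omega> < Delta n p x \<beta> s / 4"
  shows "mBIC \<gamma> n p x (response n p x \<beta> (\<lambda>i. e i \<omega>)) s\<^sub>0 < mBIC \<gamma> n p x (response n p x \<beta> (\<lambda>i. e i \<omega>)) s"
proof -
  let ?y = "response n p x \<beta> (\<lambda>i. e i \<omega>)"
  define R\<^sub>0 where "R\<^sub>0 = RSS n x ?y s\<^sub>0"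
  define R where "R = RSS n x ?y s"
  define \<rho> where "\<rho> = 8 * b\<^sup>2 * D / (n * \<sigma>\<^sup>2)"
  have fin: "finite s\<^sub>0" "finite s" using s finite_subset[of s "{1..p}"] by (auto simp: s\<^sub>0_def true_model_def)
  have lnp: "ln p > 0" "ln n \<le> ln p" "ln n > 0" using n p by auto
  have A: "A \<ge> 0" using lnp g by (simp add: A_def)
  have D: "D > 0" using lnp p0 by (simp add: D_def)
  have n0: "real n * \<sigma>\<^sup>2 > 0" using n sigma by simp
  have \<rho>: "\<rho> \<ge> 0" "n * \<sigma>\<^sup>2 * \<rho> = 8 * b\<^sup>2 * D" using D n sigma by (simp_all add: \<rho>_def)
  have R0_eq: "R\<^sub>0 = noise \<omega> \<bullet> noise \<omega> - hat_form x s\<^sub>0 \<omega>"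
    using fin bias_eq_0[of s\<^sub>0 p \<beta> x] unfolding R\<^sub>0_def RSS_response[OF fin(1)] Delta_eq by (simp add: s\<^sub>0_def)
  \<comment> \<open>With at least one true predictor the intercept at most doubles the count, which
    explains the constant 8 in \<rho>.\<close>
  have "real (Suc (card s\<^sub>0)) * ln p \<le> 2 * D" using lnp p0 by (simp add: D_def algebra_simps)
  hence "4 * b\<^sup>2 * (real (Suc (card s\<^sub>0)) * ln p) \<le> 4 * b\<^sup>2 * (2 * D)" by (intro mult_left_mono) auto
  hence "hat_form x s\<^sub>0 \<omega> < n * \<sigma>\<^sup>2 * \<rho>" using H0 unfolding \<rho>(2) by linarith
  hence R0: "R\<^sub>0 \<ge> n * \<sigma>\<^sup>2 * (1 - \<eta> - \<rho>)" using lower R0_eq by (simp add: right_diff_distrib)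
  have kA: "k * card s\<^sub>0 * A / (2 * n) \<ge> 0"
  proof -
    have "0 \<le> k * card s\<^sub>0" using s(3) by linarith
    thus ?thesis using A by simp
  qed
  have "\<rho> \<le> \<eta>" using small(1) kA by (simp add: \<rho>_def)
  hence "0 < n * \<sigma>\<^sup>2 * (1 - \<eta> - \<rho>)" using eta by (intro mult_pos_pos[OF n0]) linarith
  hence R0_pos: "R\<^sub>0 > 0" using R0 by linarith
  have R0_upper: "R\<^sub>0 \<le> 4 * b\<^sup>2 * n" using upper hat_form_nonneg[OF fin(1), of x \<omega>] R0_eq by linarith
  have "R > 0 \<and> (real (card s\<^sub>0) - card s) * A < n * ln (R / R\<^sub>0)"
  proof (cases "s\<^sub>0 \<subseteq> s")
    case True
    hence psub: "s\<^sub>0 \<subset> s" using s by auto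
    have m: "real (card (s - s\<^sub>0)) = real (card s) - card s\<^sub>0"
      using card_Diff_subset[OF fin(1) True] card_mono[OF fin(2) True] by (simp add: of_nat_diff)
    define d where "d = hat_form x s \<omega> - hat_form x s\<^sub>0 \<omega>"
    have R_eq: "R = R\<^sub>0 - d"
      using True fin bias_eq_0[of s p \<beta> x] unfolding R_def RSS_response[OF fin(2)] Delta_eq
      by (simp add: s\<^sub>0_def R0_eq d_def)
    have "card (s - s\<^sub>0) * A / (2 * n) \<le> k * card s\<^sub>0 * A / (2 * n)"
      using s(3) A by (intro divide_right_mono mult_right_mono) (auto simp: m)
    hence "\<rho> + card (s - s\<^sub>0) * A / (2 * n) \<le> \<eta>" using small(1) by (simp add: \<rho>_def)
    from mBIC_overfit_aux[OF _ A sigma R0 R0_pos \<rho>(1) this eta] over[OF psub] n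
    have "R > 0" "- (real (card (s - s\<^sub>0)) * A) < n * ln (R / R\<^sub>0)"
      by (auto simp: R_eq d_def)
    thus ?thesis by (simp add: m algebra_simps)
  next
    case False
    note under = under[OF False]
    have "R = Delta n p x \<beta> s + 2 * (bias p x \<beta> s \<bullet> noise \<omega>) + noise \<omega> \<bullet> noise \<omega> - hat_form x s \<omega>"
      unfolding R_def by (rule RSS_response[OF fin(2)])
    \<comment> \<open>The doubled linear term and the fitted noise each take at most a quarter of
      \<open>Delta\<close>. The remaining half is at least
      \<open>16 * b\<^sup>2 * ((1 + \<gamma>) * D)\<close>.\<close>
    moreover have "32 * b\<^sup>2 * ((1 + \<gamma>) * D) = 2 * (16 * b\<^sup>2 * ((1 + \<gamma>) * D))" by simp
    ultimately have R: "R \<ge> R\<^sub>0 + 16 * b\<^sup>2 * ((1 + \<gamma>) * D)"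
      using under hat_form_nonneg[OF fin(1), of x \<omega>] R0_eq by linarith
    have D': "(1 + \<gamma>) * D > 0" using D g by simp
    \<comment> \<open>A smaller model saves at most the whole penalty of the true one.\<close>
    have "(real (card s\<^sub>0) - card s) * A \<le> card s\<^sub>0 * A"
      using A by (intro mult_right_mono) auto
    also have "\<dots> \<le> card s\<^sub>0 * ((1 + 2 * \<gamma>) * ln p)"
      using lnp by (intro mult_left_mono) (auto simp: A_def algebra_simps)
    also have "\<dots> = (1 + 2 * \<gamma>) * D" by (simp add: D_def)
    also have "\<dots> < 2 * ((1 + \<gamma>) * D)" using D by (simp add: algebra_simps)
    also have "\<dots> \<le> n * ln (R / R\<^sub>0)"
      using mBIC_underfit_aux[OF _ b_pos R0_pos R0_upper R D' small(2)] n by simp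
    finally have 1: "(real (card s\<^sub>0) - card s) * A < n * ln (R / R\<^sub>0)" .
    have "0 \<le> 16 * b\<^sup>2 * ((1 + \<gamma>) * D)" using D' by simp
    hence "R > 0" using R R0_pos by linarith
    with 1 show ?thesis by blast
  qed
  thus ?thesis
    using n R0_pos unfolding R_def R\<^sub>0_def A_def by (subst mBIC_less_iff) auto
qed

text \<open>The five error terms bound, in order, the bad events \<open>B1\<close> to
  \<open>B5\<close>: too small a noise norm, too large a noise norm, too much noise fitted by the
  true model, an overfitting model gaining too much, and an underfitting model hiding its
  bias.\<close>

lemma mBIC_finite_sample:
  fixes k \<gamma> \<eta> \<sigma> L A D q :: real and p :: nat and x :: "nat \<Rightarrow> nat \<Rightarrow> real" and \<beta> :: "nat \<Rightarrow> real"
  defines "s\<^sub>0 \<equiv> true_model p \<beta>"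
  defines "A \<equiv> ln n + 2 * \<gamma> * ln p"
  defines "D \<equiv> real (card s\<^sub>0) * ln p"
  defines "q \<equiv> exp (- ((1 - 1 / L) / (2 * b\<^sup>2)) * (\<sigma>\<^sup>2 * (1 - 2 * \<eta>) * A)) * sqrt L"
  assumes n: "n \<ge> 2" and p: "p \<ge> n" and p0: "card s\<^sub>0 \<ge> 1" and k: "k > 1" and g: "\<gamma> \<ge> 0"
    and sigma: "\<sigma> > 0" and var: "\<And>i. i \<in> {1..n} \<Longrightarrow> variance (e i) = \<sigma>\<^sup>2"
    and eta: "0 < \<eta>" "\<eta> < 1 / 2" and L: "L > 1"
    and small: "8 * b\<^sup>2 * D / (n * \<sigma>\<^sup>2) + k * card s\<^sub>0 * A / (2 * n) \<le> \<eta>" "8 * ((1 + \<gamma>) * D) \<le> n"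
    and Delta: "\<And>s. s \<subseteq> {1..p} \<Longrightarrow> \<not> s\<^sub>0 \<subseteq> s \<Longrightarrow> real (card s) \<le> k * card s\<^sub>0 \<Longrightarrow>
        (128 * b\<^sup>2 * (k + 1) + 32 * b\<^sup>2 * (1 + \<gamma>)) * D \<le> Delta n p x \<beta> s"
  shows "prob {\<omega> \<in> space M. \<forall>s. s \<subseteq> {1..p} \<and> s \<noteq> s\<^sub>0 \<and> real (card s) \<le> k * card s\<^sub>0 \<longrightarrow>
      mBIC \<gamma> n p x (response n p x \<beta> (\<lambda>i. e i \<omega>)) s > mBIC \<gamma> n p x (response n p x \<beta> (\<lambda>i. e i \<omega>)) s\<^sub>0}
    \<ge> 1 - (exp (- (n * \<eta>\<^sup>2) * (\<sigma> ^ 4 / (128 * b ^ 4))) + (sqrt 2 / exp 1) ^ n + sqrt 2 / p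
           + (exp (q * p) - 1) + 2 * exp 1 / p)"
    (is "prob ?G \<ge> _")
proof -
  define T where "T = {s. s \<subseteq> {1..p} \<and> s \<noteq> s\<^sub>0 \<and> real (card s) \<le> k * card s\<^sub>0}"
  define U where "U = {s. s \<subseteq> {1..p} \<and> \<not> s\<^sub>0 \<subseteq> s \<and> real (card s) \<le> k * card s\<^sub>0}"
  have s0: "finite s\<^sub>0" "s\<^sub>0 \<subseteq> {1..p}" by (auto simp: s\<^sub>0_def true_model_def)
  have fin: "finite T" "finite U" by (rule finite_subset[of _ "Pow {1..p}"]; auto simp: T_def U_def)+
  have fs: "finite s" if "s \<subseteq> {1..p}" for s using that finite_subset by blast
  have p2: "p \<ge> 2" using n p by simp
  have lnp: "ln p > 0" using p2 by simp
  have D: "D \<ge> 0" using lnp by (simp add: D_def)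
  define B1 where "B1 = {\<omega> \<in> space M. noise \<omega> \<bullet> noise \<omega> \<le> n * \<sigma>\<^sup>2 * (1 - \<eta>)}"
  define B2 where "B2 = {\<omega> \<in> space M. 4 * b\<^sup>2 * n \<le> noise \<omega> \<bullet> noise \<omega>}"
  define B3 where "B3 = {\<omega> \<in> space M. 4 * b\<^sup>2 * (real (Suc (card s\<^sub>0)) * ln p) \<le> hat_form x s\<^sub>0 \<omega>}"
  define B4 where "B4 = (\<Union>s\<in>{s. s \<subseteq> {1..p} \<and> s\<^sub>0 \<subset> s}.
      {\<omega> \<in> space M. card (s - s\<^sub>0) * (\<sigma>\<^sup>2 * (1 - 2 * \<eta>) * A) \<le> hat_form x s \<omega> - hat_form x s\<^sub>0 \<omega>})"
  define B5 where "B5 = (\<Union>s\<in>U.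
      {\<omega> \<in> space M. bias p x \<beta> s \<bullet> noise \<omega> \<le> - Delta n p x \<beta> s / 8} \<union>
      {\<omega> \<in> space M. Delta n p x \<beta> s / 4 \<le> hat_form x s \<omega>})"
  \<comment> \<open>The constant in the assumption on \<open>Delta\<close> is a sum of two: the
    first serves the union bound, the second the gap in the residual sums of squares.\<close>
  have DU: "128 * b\<^sup>2 * (k + 1) * D \<le> Delta n p x \<beta> s" "32 * b\<^sup>2 * ((1 + \<gamma>) * D) \<le> Delta n p x \<beta> s"
    if "s \<in> U" for s
  proof -
    have "(128 * b\<^sup>2 * (k + 1) + 32 * b\<^sup>2 * (1 + \<gamma>)) * D \<le> Delta n p x \<beta> s"
      using Delta[of s] that by (auto simp: U_def)
    moreover have "(128 * b\<^sup>2 * (k + 1) + 32 * b\<^sup>2 * (1 + \<gamma>)) * D = 128 * b\<^sup>2 * (k + 1) * D + 32 * b\<^sup>2 * ((1 + \<gamma>) * D)"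
      by (simp only: distrib_right mult.assoc)
    moreover have "128 * b\<^sup>2 * (k + 1) * D \<ge> 0" "32 * b\<^sup>2 * ((1 + \<gamma>) * D) \<ge> 0" using k g D by auto
    ultimately show "128 * b\<^sup>2 * (k + 1) * D \<le> Delta n p x \<beta> s" "32 * b\<^sup>2 * ((1 + \<gamma>) * D) \<le> Delta n p x \<beta> s"
      by linarith+
  qed
  have "prob B1 \<le> exp (- (n * \<eta>\<^sup>2) * (\<sigma> ^ 4 / (128 * b ^ 4)))"
    unfolding B1_def by (rule norm_lower_tail[OF var sigma eta(1)])
  moreover have "prob B2 \<le> (sqrt 2 / exp 1) ^ n" unfolding B2_def by (rule norm_upper_tail)
  moreover have "prob B3 \<le> sqrt 2 / p" unfolding B3_def by (rule true_model_tail[OF s0(1) p2])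
  moreover have "prob B4 \<le> exp (q * p) - 1"
    using overfit_tail[OF finite_atLeastAtMost s0(2) L] unfolding B4_def q_def by simp
  moreover have "prob B5 \<le> 2 * exp 1 / p"
    unfolding B5_def
    by (rule underfit_tail[OF p2 p0 k]) (use DU in \<open>auto simp: U_def D_def\<close>)
  moreover have meas: "B1 \<in> events" "B2 \<in> events" "B3 \<in> events" "B4 \<in> events" "B5 \<in> events"
  proof -
    show "B1 \<in> events" "B2 \<in> events" unfolding B1_def B2_def by measurable
    show "B3 \<in> events" using s0 unfolding B3_def by measurable
    show "B4 \<in> events"
      unfolding B4_def
    proof (rule sets.finite_UN)
      fix s assume "s \<in> {s. s \<subseteq> {1..p} \<and> s\<^sub>0 \<subset> s}"
      hence "finite s" using fs by auto
      thus "{\<omega> \<in> space M. card (s - s\<^sub>0) * (\<sigma>\<^sup>2 * (1 - 2 * \<eta>) * A) \<le> hat_form x s \<omega> - hat_form x s\<^sub>0 \<omega>} \<in> events"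
        using s0 by measurable
    qed (rule finite_subset[of _ "Pow {1..p}"], auto)
    show "B5 \<in> events"
      unfolding B5_def
    proof (rule sets.finite_UN[OF fin(2)])
      fix s assume "s \<in> U"
      hence "finite s" using fs by (auto simp: U_def)
      thus "{\<omega> \<in> space M. bias p x \<beta> s \<bullet> noise \<omega> \<le> - Delta n p x \<beta> s / 8} \<union>
        {\<omega> \<in> space M. Delta n p x \<beta> s / 4 \<le> hat_form x s \<omega>} \<in> events"
        by measurable
    qed
  qed
  moreover have "prob (B1 \<union> B2 \<union> B3 \<union> B4 \<union> B5) \<le> prob B1 + prob B2 + prob B3 + prob B4 + prob B5"
    using meas by (intro order_trans[OF measure_Un_le] add_mono order_refl) auto
  moreover have G: "?G \<in> events"
  proof -
    have "?G = {\<omega> \<in> space M. \<forall>s\<in>T. mBIC \<gamma> n p x (response n p x \<beta> (\<lambda>i. e i \<omega>)) s > mBIC \<gamma> n p x (response n p x \<beta> (\<lambda>i. e i \<omega>)) s\<^sub>0}"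
      by (auto simp: T_def)
    also have "\<dots> \<in> events"
    proof (rule sets.sets_Collect_finite_All[OF _ fin(1)])
      fix s assume "s \<in> T"
      hence "finite s" using fs by (auto simp: T_def)
      thus "{\<omega> \<in> space M. mBIC \<gamma> n p x (response n p x \<beta> (\<lambda>i. e i \<omega>)) s > mBIC \<gamma> n p x (response n p x \<beta> (\<lambda>i. e i \<omega>)) s\<^sub>0} \<in> events"
        using s0 by measurable
    qed
    finally show ?thesis .
  qed
  \<comment> \<open>A failing outcome provides one particular competitor, to which
    \<open>mBIC_good_event\<close> applies unless some bad event occurs.\<close>
  moreover have "space M - ?G \<subseteq> B1 \<union> B2 \<union> B3 \<union> B4 \<union> B5"
  proof
    fix \<omega> assume \<omega>: "\<omega> \<in> space M - ?G"
    then obtain s where s: "s \<subseteq> {1..p}" "s \<noteq> s\<^sub>0" "real (card s) \<le> k * card s\<^sub>0"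
      "\<not> mBIC \<gamma> n p x (response n p x \<beta> (\<lambda>i. e i \<omega>)) s\<^sub>0 < mBIC \<gamma> n p x (response n p x \<beta> (\<lambda>i. e i \<omega>)) s"
      by auto
    show "\<omega> \<in> B1 \<union> B2 \<union> B3 \<union> B4 \<union> B5"
    proof (rule ccontr)
      assume good: "\<omega> \<notin> B1 \<union> B2 \<union> B3 \<union> B4 \<union> B5"
      have sU: "s \<in> U" if "\<not> s\<^sub>0 \<subseteq> s" using that s by (auto simp: U_def)
      have "mBIC \<gamma> n p x (response n p x \<beta> (\<lambda>i. e i \<omega>)) s\<^sub>0 < mBIC \<gamma> n p x (response n p x \<beta> (\<lambda>i. e i \<omega>)) s"
      proof (rule mBIC_good_event[where \<beta> = \<beta>, OF n p _ g sigma eta(2), folded s\<^sub>0_def])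
        show "n * \<sigma>\<^sup>2 * (1 - \<eta>) < noise \<omega> \<bullet> noise \<omega>" using good \<omega> by (auto simp: B1_def)
        show "noise \<omega> \<bullet> noise \<omega> < 4 * b\<^sup>2 * n" using good \<omega> by (auto simp: B2_def)
        show "hat_form x s\<^sub>0 \<omega> < 4 * b\<^sup>2 * (real (Suc (card s\<^sub>0)) * ln p)" using good \<omega> by (auto simp: B3_def)
        show "hat_form x s \<omega> - hat_form x s\<^sub>0 \<omega> < card (s - s\<^sub>0) * (\<sigma>\<^sup>2 * (1 - 2 * \<eta>) * (ln n + 2 * \<gamma> * ln p))"
          if "s\<^sub>0 \<subset> s"
        proof -
          have "\<omega> \<notin> {\<omega> \<in> space M. card (s - s\<^sub>0) * (\<sigma>\<^sup>2 * (1 - 2 * \<eta>) * A) \<le> hat_form x s \<omega> - hat_form x s\<^sub>0 \<omega>}"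
            using good that s(1) unfolding B4_def by blast
          thus ?thesis using \<omega> by (simp add: A_def not_le)
        qed
        have 5: "\<not> bias p x \<beta> s \<bullet> noise \<omega> \<le> - Delta n p x \<beta> s / 8"
          "\<not> Delta n p x \<beta> s / 4 \<le> hat_form x s \<omega>" if "\<not> s\<^sub>0 \<subseteq> s"
          using good \<omega> sU[OF that] unfolding B5_def by blast+
        show "- Delta n p x \<beta> s / 8 < bias p x \<beta> s \<bullet> noise \<omega>" if "\<not> s\<^sub>0 \<subseteq> s"
          using 5[OF that] by linarith
        show "hat_form x s \<omega> < Delta n p x \<beta> s / 4" if "\<not> s\<^sub>0 \<subseteq> s"
          using 5[OF that] by linarith
        show "32 * b\<^sup>2 * ((1 + \<gamma>) * (real (card s\<^sub>0) * ln p)) \<le> Delta n p x \<beta> s" if "\<not> s\<^sub>0 \<subseteq> s"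
          using DU(2)[OF sU[OF that]] by (simp add: D_def)
      qed (fact p0 s small[unfolded D_def A_def])+
      thus False using s by simp
    qed
  qed
  hence "prob (space M - ?G) \<le> prob (B1 \<union> B2 \<union> B3 \<union> B4 \<union> B5)"
    using meas by (intro finite_measure_mono) auto
  ultimately show ?thesis using prob_compl[OF G] by linarith
qed

end

subsection \<open>Asymptotics\<close>

locale sparse_regression =
  fixes p p\<^sub>0 :: "nat \<Rightarrow> nat"
    and x :: "nat \<Rightarrow> nat \<Rightarrow> nat \<Rightarrow> real"
    and \<beta> :: "nat \<Rightarrow> nat \<Rightarrow> real"
    and M :: "nat \<Rightarrow> 'a measure"
    and \<epsilon> :: "nat \<Rightarrow> nat \<Rightarrow> 'a \<Rightarrow> real"
    and b \<sigma> \<gamma> k :: real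
  assumes prob: "\<And>n. n \<ge> 1 \<Longrightarrow> prob_space (M n)"
    and indep: "\<And>n. n \<ge> 1 \<Longrightarrow> prob_space.indep_vars (M n) (\<lambda>_. borel) (\<epsilon> n) {1..n}"
    and subg: "\<And>n i. 1 \<le> i \<Longrightarrow> i \<le> n \<Longrightarrow> subgaussian b (M n) (\<epsilon> n i)"
    and var: "\<And>n i. 1 \<le> i \<Longrightarrow> i \<le> n \<Longrightarrow> prob_space.variance (M n) (\<epsilon> n i) = \<sigma>\<^sup>2"
    and sigma: "\<sigma> > 0"
    and p_ge: "\<And>n. n \<ge> 1 \<Longrightarrow> p n \<ge> n"
    and p0_def: "\<And>n. p\<^sub>0 n = card (true_model (p n) (\<beta> n))"
    and p0_ge: "\<And>n. n \<ge> 1 \<Longrightarrow> p\<^sub>0 n \<ge> 1"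
    and k: "k > 1"
    and cond: "consistency_condition k p x \<beta>"
    and gamma: "\<gamma> \<ge> 0"
begin

lemma b_pos: "b > 0"
  using subg[of 1 1] by (simp add: subgaussian_def)

lemma errors_subgaussian_noise: "n \<ge> 1 \<Longrightarrow> subgaussian_noise (M n) (\<epsilon> n) n b"
  using prob indep subg b_pos by (simp add: subgaussian_noise_def subgaussian_noise_axioms_def)

abbreviation D :: "nat \<Rightarrow> real" where
  "D n \<equiv> real (p\<^sub>0 n) * ln (real (p n))"

lemma ln_p_ge: "n \<ge> 1 \<Longrightarrow> ln (real n) \<le> ln (real (p n))"
  using p_ge[of n] by simp

lemma ln_p_at_top: "filterlim (\<lambda>n. ln (real (p n))) at_top sequentially"
proof (rule filterlim_at_top_mono)
  show "filterlim (\<lambda>n. ln (real n)) at_top sequentially" by real_asymp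
  show "eventually (\<lambda>n. ln (real n) \<le> ln (real (p n))) sequentially"
    using eventually_ge_at_top[of 1] by eventually_elim (rule ln_p_ge)
qed

lemma p_at_top: "filterlim (\<lambda>n. real (p n)) at_top sequentially"
proof (rule filterlim_at_top_mono)
  show "filterlim (\<lambda>n. real n) at_top sequentially" by real_asymp
  show "eventually (\<lambda>n. real n \<le> real (p n)) sequentially"
    using eventually_ge_at_top[of 1] by eventually_elim (use p_ge in auto)
qed

text \<open>Unfolds the consistency condition: the minimum is over a finite set, so every competing
  model inherits its lower bound, with an arbitrary constant \<open>C\<close>.\<close>

lemma eventually_Delta_ge:
  "\<forall>\<^sub>F n in sequentially. \<forall>s. s \<subseteq> {1..p n} \<and> \<not> true_model (p n) (\<beta> n) \<subseteq> s \<and> real (card s) \<le> k * p\<^sub>0 n \<longrightarrow>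
      C * D n \<le> Delta n (p n) (x n) (\<beta> n) s"
proof -
  define S where "S n = {s. s \<subseteq> {1..p n} \<and> \<not> true_model (p n) (\<beta> n) \<subseteq> s \<and> real (card s) \<le> k * p\<^sub>0 n}" for n
  have "eventually (\<lambda>n. C \<le> Min {Delta n (p n) (x n) (\<beta> n) s / D n | s. s \<in> S n}) sequentially"
    using cond unfolding consistency_condition_def Let_def p0_def[symmetric] S_def filterlim_at_top by simp
  thus ?thesis using eventually_ge_at_top[of 2]
  proof eventually_elim
    case (elim n)
    have fin: "finite (S n)" by (rule finite_subset[of _ "Pow {1..p n}"]) (auto simp: S_def)
    have "D n > 0" using elim p_ge[of n] p0_ge[of n] by simp
    moreover have "C \<le> Delta n (p n) (x n) (\<beta> n) s / D n" if "s \<in> S n" for s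
    proof -
      have "Min {Delta n (p n) (x n) (\<beta> n) s / D n | s. s \<in> S n} \<le> Delta n (p n) (x n) (\<beta> n) s / D n"
        by (rule Min_le) (use that fin in auto)
      thus ?thesis using elim(1) by linarith
    qed
    ultimately have "C * D n \<le> Delta n (p n) (x n) (\<beta> n) s" if "s \<in> S n" for s
      using that by (simp add: field_simps)
    thus ?case by (auto simp: S_def)
  qed
qed

section \<open>Consistency from vanishing error terms\<close>

definition penalty :: "nat \<Rightarrow> real" where
  "penalty n = ln (real n) + 2 * \<gamma> * ln (real (p n))"

text \<open>The base \<open>q\<close> of \<open>mBIC_finite_sample\<close> at sample size
  \<open>n\<close>; the union bound requires that its product with \<open>p n\<close>
  vanish.\<close>

definition overfit_rate :: "real \<Rightarrow> real \<Rightarrow> nat \<Rightarrow> real" where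
  "overfit_rate \<eta> L n =
     exp (- ((1 - 1 / L) / (2 * b\<^sup>2)) * (\<sigma>\<^sup>2 * (1 - 2 * \<eta>) * penalty n)) * sqrt L"

text \<open>Reduces consistency to a choice of the sequences \<eta> and \<open>L\<close>. Three
  limits must be checked: the true model and the penalties are small against
  \<open>n * \<eta> n\<close>, the noise norm concentrates at scale \<eta>, and overfitting is
  unlikely.\<close>

lemma mBIC_consistentI:
  fixes \<eta> L :: "nat \<Rightarrow> real"
  assumes ev: "\<forall>\<^sub>F n in sequentially. 0 < \<eta> n \<and> \<eta> n < 1 / 2 \<and> L n > 1"
    and D_small: "(\<lambda>n. D n / (n * \<eta> n)) \<longlonglongrightarrow> 0"
    and eta_large: "filterlim (\<lambda>n. n * (\<eta> n)\<^sup>2) at_top sequentially"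
    and rate: "(\<lambda>n. overfit_rate (\<eta> n) (L n) n * p n) \<longlonglongrightarrow> 0"
  shows "mBIC_consistent \<gamma> k p x \<beta> M \<epsilon>"
proof -
  define err where "err n = exp (- (n * (\<eta> n)\<^sup>2) * (\<sigma> ^ 4 / (128 * b ^ 4))) + (sqrt 2 / exp 1) ^ n + sqrt 2 / p n
           + (exp (overfit_rate (\<eta> n) (L n) n * p n) - 1) + 2 * exp 1 / p n" for n
  define P where "P n = measure (M n) {\<omega> \<in> space (M n).
           \<forall>s. s \<subseteq> {1..p n} \<and> s \<noteq> true_model (p n) (\<beta> n) \<and> real (card s) \<le> k * p\<^sub>0 n \<longrightarrow>
             mBIC \<gamma> n (p n) (x n) (response n (p n) (x n) (\<beta> n) (\<lambda>i. \<epsilon> n i \<omega>)) s >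
             mBIC \<gamma> n (p n) (x n) (response n (p n) (x n) (\<beta> n) (\<lambda>i. \<epsilon> n i \<omega>)) (true_model (p n) (\<beta> n))}" for n
  have "filterlim (\<lambda>n. - (n * (\<eta> n)\<^sup>2) * (\<sigma> ^ 4 / (128 * b ^ 4))) at_bot sequentially"
    unfolding mult_minus_left filterlim_uminus_at_bot minus_minus
    using sigma b_pos by (intro filterlim_at_top_mult_tendsto_pos[OF tendsto_const _ eta_large]) auto
  hence err1: "(\<lambda>n. exp (- (n * (\<eta> n)\<^sup>2) * (\<sigma> ^ 4 / (128 * b ^ 4)))) \<longlonglongrightarrow> 0"
    by (rule filterlim_compose[OF exp_at_bot])
  have "sqrt 2 < sqrt 4" by (rule real_sqrt_less_mono) simp
  also have "sqrt 4 \<le> exp (1::real)" using exp_ge_add_one_self[of "1 :: real"] by simp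
  finally have err2: "(\<lambda>n. (sqrt 2 / exp (1::real)) ^ n) \<longlonglongrightarrow> 0" by (intro LIMSEQ_power_zero) simp
  have err3: "(\<lambda>n. C / real (p n)) \<longlonglongrightarrow> 0" for C
    by (intro tendsto_divide_0[OF tendsto_const] filterlim_at_top_imp_at_infinity p_at_top)
  have err4: "(\<lambda>n. exp (overfit_rate (\<eta> n) (L n) n * p n) - 1) \<longlonglongrightarrow> exp 0 - 1"
    by (intro tendsto_intros rate)
  have "err \<longlonglongrightarrow> 0 + 0 + 0 + (exp 0 - 1) + 0"
    unfolding err_def by (intro tendsto_add err1 err2 err3 err4)
  hence err: "err \<longlonglongrightarrow> 0" by simp
  \<comment> \<open>Adds up the constants of all smallness conditions of the finite-sample bound, so
    that the single inequality \<open>c * (D n / n) \<le> \<eta> n\<close> implies each of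
    them.\<close>
  define c where "c = 8 * b\<^sup>2 / \<sigma>\<^sup>2 + k * (1 + 2 * \<gamma>) / 2 + 8 * (1 + \<gamma>)"
  have c: "c > 0" unfolding c_def using k gamma by (intro add_nonneg_pos) auto
  have "eventually (\<lambda>n. D n / (n * \<eta> n) < 1 / c) sequentially"
    using order_tendstoD(2)[OF D_small, of "1 / c"] c by simp
  hence lower: "eventually (\<lambda>n. 1 - err n \<le> P n) sequentially"
    using ev eventually_ge_at_top[of 2]
      eventually_Delta_ge[of "128 * b\<^sup>2 * (k + 1) + 32 * b\<^sup>2 * (1 + \<gamma>)"]
  proof eventually_elim
    case (elim n)
    hence n: "n \<ge> 2" "n \<ge> 1" and eta: "0 < \<eta> n" "\<eta> n < 1 / 2" and L: "L n > 1" by auto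
    interpret subgaussian_noise "M n" "\<epsilon> n" n b by (rule errors_subgaussian_noise[OF n(2)])
    have "p n \<ge> 2" using p_ge[of n] n by simp
    hence lnp: "ln (p n) > 0" "ln n \<le> ln (p n)" using ln_p_ge[of n] n by auto
    have D: "D n \<ge> 0" using lnp by simp
    have cD: "c * (D n / n) \<le> \<eta> n" using elim(1) c eta n by (simp add: field_simps)
    have pos: "8 * b\<^sup>2 / \<sigma>\<^sup>2 * (D n / n) \<ge> 0" "k * (1 + 2 * \<gamma>) / 2 * (D n / n) \<ge> 0" "8 * (1 + \<gamma>) * (D n / n) \<ge> 0"
      using D k gamma by auto
    have cD': "c * (D n / n) = 8 * b\<^sup>2 / \<sigma>\<^sup>2 * (D n / n) + k * (1 + 2 * \<gamma>) / 2 * (D n / n) + 8 * (1 + \<gamma>) * (D n / n)"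
      by (simp only: c_def distrib_right)
    have small1: "8 * b\<^sup>2 * D n / (n * \<sigma>\<^sup>2) + k * p\<^sub>0 n * (ln n + 2 * \<gamma> * ln (p n)) / (2 * n) \<le> \<eta> n"
    proof -
      have "k * p\<^sub>0 n * (ln n + 2 * \<gamma> * ln (p n)) / (2 * n) \<le> k * p\<^sub>0 n * ((1 + 2 * \<gamma>) * ln (p n)) / (2 * n)"
        using lnp k by (intro divide_right_mono mult_left_mono) (auto simp: algebra_simps)
      also have "\<dots> = k * (1 + 2 * \<gamma>) / 2 * (D n / n)" by simp
      finally have "k * p\<^sub>0 n * (ln n + 2 * \<gamma> * ln (p n)) / (2 * n) \<le> k * (1 + 2 * \<gamma>) / 2 * (D n / n)" .
      moreover have "8 * b\<^sup>2 * D n / (n * \<sigma>\<^sup>2) = 8 * b\<^sup>2 / \<sigma>\<^sup>2 * (D n / n)" by simp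
      ultimately show ?thesis using cD cD' pos by linarith
    qed
    have "8 * (1 + \<gamma>) * (D n / n) \<le> 1" using cD cD' pos eta by linarith
    hence small2: "8 * ((1 + \<gamma>) * D n) \<le> n" using n by (simp add: field_simps)
    show ?case
      unfolding P_def err_def overfit_rate_def penalty_def p0_def
    proof (rule mBIC_finite_sample[OF n(1) p_ge[OF n(2)] p0_ge[OF n(2), unfolded p0_def] k gamma sigma _ eta L
          small1[unfolded p0_def] small2[unfolded p0_def]])
      show "variance (\<epsilon> n i) = \<sigma>\<^sup>2" if "i \<in> {1..n}" for i using var[of i n] that by simp
      show "(128 * b\<^sup>2 * (k + 1) + 32 * b\<^sup>2 * (1 + \<gamma>)) * (real (card (true_model (p n) (\<beta> n))) * ln (real (p n)))
          \<le> Delta n (p n) (x n) (\<beta> n) s"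
        if "s \<subseteq> {1..p n}" "\<not> true_model (p n) (\<beta> n) \<subseteq> s" "real (card s) \<le> k * card (true_model (p n) (\<beta> n))" for s
        using elim(4) that unfolding p0_def by blast
    qed
  qed
  have upper: "eventually (\<lambda>n. P n \<le> 1) sequentially"
    using eventually_ge_at_top[of 1]
  proof eventually_elim
    case (elim n)
    thus ?case unfolding P_def by (rule prob_space.prob_le_1[OF prob])
  qed
  have "(\<lambda>n. 1 - err n) \<longlonglongrightarrow> 1" using tendsto_diff[OF tendsto_const err, of 1] by simp
  hence "P \<longlonglongrightarrow> 1" by (rule tendsto_sandwich[OF lower upper _ tendsto_const])
  thus ?thesis unfolding mBIC_consistent_def Let_def P_def p0_def .
qed

lemma overfit_rate_eq:
  assumes "p n \<ge> 1" "L > 1"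
  shows "overfit_rate \<eta> L n * p n =
     exp (ln (p n) - (1 - 1 / L) * (1 - 2 * \<eta>) * (\<sigma>\<^sup>2 / (2 * b\<^sup>2)) * penalty n + ln L / 2)"
proof -
  have "sqrt L = exp (ln L / 2)"
    using assms by (intro real_sqrt_unique) (auto simp: power2_eq_square simp flip: exp_add)
  moreover have "real (p n) = exp (ln (p n))" using assms by simp
  ultimately have "overfit_rate \<eta> L n * p n =
     exp (- ((1 - 1 / L) / (2 * b\<^sup>2)) * (\<sigma>\<^sup>2 * (1 - 2 * \<eta>) * penalty n)) * exp (ln L / 2) * exp (ln (p n))"
    unfolding overfit_rate_def by simp
  thus ?thesis by (simp add: exp_add[symmetric] field_simps)
qed

text \<open>On the logarithmic scale of \<open>overfit_rate_eq\<close> the assumption bounds the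
  product by \<open>exp C\<close> times \<open>n powr (- c)\<close>.\<close>

lemma overfit_rate_tendsto_0:
  assumes c: "c > 0"
    and "\<forall>\<^sub>F n in sequentially. L n > 1 \<and>
      ln (p n) - (1 - 1 / L n) * (1 - 2 * \<eta> n) * (\<sigma>\<^sup>2 / (2 * b\<^sup>2)) * penalty n + ln (L n) / 2 \<le> C - c * ln n"
  shows "(\<lambda>n. overfit_rate (\<eta> n) (L n) n * p n) \<longlonglongrightarrow> 0"
proof (rule tendsto_sandwich[OF _ _ tendsto_const])
  show "\<forall>\<^sub>F n in sequentially. overfit_rate (\<eta> n) (L n) n * p n \<le> exp (C - c * ln n)"
    using assms(2) eventually_ge_at_top[of 1]
  proof eventually_elim
    case (elim n)
    hence "p n \<ge> 1" using p_ge[of n] by simp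
    thus ?case using elim by (subst overfit_rate_eq) auto
  qed
  show "\<forall>\<^sub>F n in sequentially. 0 \<le> overfit_rate (\<eta> n) (L n) n * p n"
    using assms(2) by eventually_elim (auto simp: overfit_rate_def)
  show "(\<lambda>n. exp (C - c * ln (real n))) \<longlonglongrightarrow> 0" using c by real_asymp
qed

lemma mBIC_consistent_const:
  assumes D_small: "(\<lambda>n. D n / n) \<longlonglongrightarrow> 0" and \<tau>: "0 < \<tau>" "\<tau> < 1" and c: "c > 0"
    and bound: "\<forall>\<^sub>F n in sequentially.
      ln (p n) - (1 - \<tau>)\<^sup>2 * (\<sigma>\<^sup>2 / (2 * b\<^sup>2)) * penalty n \<le> C - c * ln n"
  shows "mBIC_consistent \<gamma> k p x \<beta> M \<epsilon>"
\<comment> \<open>With \<open>\<eta> = \<tau> / 2\<close> and \<open>L = 1 / \<tau>\<close>, the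
  factors \<open>1 - 1 / L\<close> and \<open>1 - 2 * \<eta>\<close> both equal
  \<open>1 - \<tau>\<close>, which produces the square in the assumption.\<close>
proof (rule mBIC_consistentI[of "\<lambda>_. \<tau> / 2" "\<lambda>_. 1 / \<tau>"])
  show "(\<lambda>n. D n / (real n * (\<tau> / 2))) \<longlonglongrightarrow> 0"
    using tendsto_divide[OF D_small tendsto_const, of "\<tau> / 2"] \<tau> by simp
  show "filterlim (\<lambda>n. real n * (\<tau> / 2)\<^sup>2) at_top sequentially" using \<tau> by real_asymp
  show "(\<lambda>n. overfit_rate (\<tau> / 2) (1 / \<tau>) n * p n) \<longlonglongrightarrow> 0"
    by (rule overfit_rate_tendsto_0[OF c, of _ _ "C + ln (1 / \<tau>) / 2"], use bound in eventually_elim)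
       (use \<tau> in \<open>simp add: power2_eq_square\<close>)
qed (use \<tau> in auto)

section \<open>The regimes above, below and at the critical penalty\<close>

lemma mBIC_consistent_large_gamma:
  assumes o: "D \<in> o(\<lambda>n. real n)" and g: "\<gamma> > b\<^sup>2 / \<sigma>\<^sup>2"
  shows "mBIC_consistent \<gamma> k p x \<beta> M \<epsilon>"
proof -
  define s where "s = \<sigma>\<^sup>2 / (2 * b\<^sup>2)"
  \<comment> \<open>The coefficient of \<open>ln (p n)\<close> in the penalty after scaling, equal
    to \<open>\<gamma> * \<sigma>\<^sup>2 / b\<^sup>2\<close>. It exceeds 1 here, so by continuity
    at 0 some positive \<tau> keeps \<open>(1 - \<tau>)\<^sup>2 * r\<close> above 1.\<close>
  define r where "r = 2 * \<gamma> * s"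
  have "s > 0" using b_pos sigma by (simp add: s_def)
  have "r > 1" using g b_pos sigma by (simp add: r_def s_def field_simps)
  have "((\<lambda>\<tau>. 1 - (1 - \<tau>)\<^sup>2 * r) \<longlongrightarrow> 1 - (1 - 0)\<^sup>2 * r) (at_right 0)" by (intro tendsto_intros)
  hence "\<forall>\<^sub>F \<tau> in at_right 0. 1 - (1 - \<tau>)\<^sup>2 * r < 0"
    by (rule order_tendstoD(2)) (use \<open>r > 1\<close> in simp)
  moreover have "\<forall>\<^sub>F \<tau>::real in at_right 0. 0 < \<tau> \<and> \<tau> < 1"
    using eventually_at_right_real[of 0 1] by (auto elim: eventually_mono)
  ultimately obtain \<tau> where \<tau>: "1 - (1 - \<tau>)\<^sup>2 * r < 0" "0 < \<tau>" "\<tau> < 1"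
    using eventually_happens'[OF trivial_limit_at_right_real eventually_conj] by blast
  show ?thesis
  proof (rule mBIC_consistent_const[OF smalloD_tendsto[OF o] \<tau>(2,3), of "(1 - \<tau>)\<^sup>2 * r - 1" 0])
    show "\<forall>\<^sub>F n in sequentially. ln (p n) - (1 - \<tau>)\<^sup>2 * (\<sigma>\<^sup>2 / (2 * b\<^sup>2)) * penalty n \<le> 0 - ((1 - \<tau>)\<^sup>2 * r - 1) * ln n"
      using eventually_ge_at_top[of 1]
    proof eventually_elim
      case (elim n)
      have "0 \<le> (1 - \<tau>)\<^sup>2 * s * ln n" using elim \<open>s > 0\<close> by simp
      moreover have "(1 - \<tau>)\<^sup>2 * s * penalty n = (1 - \<tau>)\<^sup>2 * s * ln n + (1 - \<tau>)\<^sup>2 * r * ln (p n)"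
        by (simp add: penalty_def r_def algebra_simps)
      \<comment> \<open>The surplus is a positive multiple of \<open>ln (p n)\<close>, hence at
        least that multiple of \<open>ln n\<close>.\<close>
      moreover have "((1 - \<tau>)\<^sup>2 * r - 1) * ln n \<le> ((1 - \<tau>)\<^sup>2 * r - 1) * ln (p n)"
        using \<tau> ln_p_ge[OF elim] by (intro mult_left_mono) auto
      moreover have "((1 - \<tau>)\<^sup>2 * r - 1) * ln (p n) = (1 - \<tau>)\<^sup>2 * r * ln (p n) - ln (p n)"
        by (simp add: left_diff_distrib)
      ultimately show ?case unfolding s_def by linarith
    qed
  qed (use \<tau> in simp)
qed

lemma mBIC_consistent_small_gamma:
  assumes g: "\<gamma> < b\<^sup>2 / \<sigma>\<^sup>2" and \<alpha>: "\<alpha> < 1" "(\<lambda>n. real (p\<^sub>0 n)) \<in> O(\<lambda>n. real n powr \<alpha>)"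
    and \<delta>: "\<delta> < 1 / (2 * (b\<^sup>2 / \<sigma>\<^sup>2 - \<gamma>))" "(\<lambda>n. real (p n)) \<in> O(\<lambda>n. real n powr \<delta>)"
  shows "mBIC_consistent \<gamma> k p x \<beta> M \<epsilon>"
proof -
  obtain a where a: "a > 0" "\<forall>\<^sub>F n in sequentially. norm (real (p\<^sub>0 n)) \<le> a * norm (real n powr \<alpha>)"
    using landau_o.bigE[OF \<alpha>(2)] by blast
  obtain B where B: "B > 0" "\<forall>\<^sub>F n in sequentially. norm (real (p n)) \<le> B * norm (real n powr \<delta>)"
    using landau_o.bigE[OF \<delta>(2)] by blast
  have lnp: "\<forall>\<^sub>F n in sequentially. ln (p n) \<le> ln B + \<delta> * ln n"
    using B(2) eventually_ge_at_top[of 1]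
  proof eventually_elim
    case (elim n)
    have "ln (p n) \<le> ln (B * n powr \<delta>)" using elim p_ge[of n] by (intro ln_mono) auto
    also have "\<dots> = ln B + \<delta> * ln n" using B(1) elim by (simp add: ln_mult ln_powr)
    finally show ?case .
  qed
  \<comment> \<open>The logarithm of \<open>p n\<close> is at most of order \<open>ln n\<close>, so
    the power \<open>n powr (\<alpha> - 1)\<close> decides.\<close>
  have D_small: "(\<lambda>n. D n / n) \<longlonglongrightarrow> 0"
  proof (rule tendsto_sandwich[OF _ _ tendsto_const])
    show "\<forall>\<^sub>F n in sequentially. D n / n \<le> a * n powr \<alpha> * (ln B + \<delta> * ln n) / n"
      using a(2) lnp eventually_ge_at_top[of 1]
    proof eventually_elim
      case (elim n)
      have "0 \<le> ln (real (p n))" using elim p_ge[of n] by simp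
      thus ?case using elim a by (intro divide_right_mono mult_mono) auto
    qed
    show "\<forall>\<^sub>F n in sequentially. 0 \<le> D n / n"
      using eventually_ge_at_top[of 1] by eventually_elim (use p_ge in force)
    show "(\<lambda>n. a * real n powr \<alpha> * (ln B + \<delta> * ln (real n)) / real n) \<longlonglongrightarrow> 0"
      using \<alpha>(1) by real_asymp
  qed
  define s where "s = \<sigma>\<^sup>2 / (2 * b\<^sup>2)"
  define r where "r = 2 * \<gamma> * s"
  have s: "s > 0" using b_pos sigma by (simp add: s_def)
  have r: "0 \<le> r" "r < 1" using g gamma s b_pos sigma by (simp_all add: r_def s_def field_simps)
  \<comment> \<open>The threshold for \<delta> is where the excess \<open>(1 - r) * \<delta>\<close>
    of the union bound meets the contribution \<open>s\<close> of the \<open>ln n\<close> part of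
    the penalty.\<close>
  have eq: "1 / (2 * (b\<^sup>2 / \<sigma>\<^sup>2 - \<gamma>)) = s / (1 - r)"
    using g b_pos sigma by (simp add: r_def s_def field_simps)
  have "\<delta> < s / (1 - r)" using \<delta>(1) unfolding eq .
  hence neg: "(1 - r) * \<delta> - s < 0" using r by (simp add: pos_less_divide_eq mult.commute)
  have "((\<lambda>\<tau>. (1 - (1 - \<tau>)\<^sup>2 * r) * \<delta> - (1 - \<tau>)\<^sup>2 * s) \<longlongrightarrow> (1 - (1 - 0)\<^sup>2 * r) * \<delta> - (1 - 0)\<^sup>2 * s) (at_right 0)"
    by (intro tendsto_intros)
  hence "\<forall>\<^sub>F \<tau> in at_right 0. (1 - (1 - \<tau>)\<^sup>2 * r) * \<delta> - (1 - \<tau>)\<^sup>2 * s < 0"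
    by (rule order_tendstoD(2)) (use neg in simp)
  moreover have "\<forall>\<^sub>F \<tau>::real in at_right 0. 0 < \<tau> \<and> \<tau> < 1"
    using eventually_at_right_real[of 0 1] by (auto elim: eventually_mono)
  ultimately obtain \<tau> where \<tau>: "(1 - (1 - \<tau>)\<^sup>2 * r) * \<delta> - (1 - \<tau>)\<^sup>2 * s < 0" "0 < \<tau>" "\<tau> < 1"
    using eventually_happens'[OF trivial_limit_at_right_real eventually_conj] by blast
  define u where "u = (1 - \<tau>)\<^sup>2"
  have u: "0 \<le> u" "u \<le> 1" using \<tau> by (auto simp: u_def power_le_one)
  \<comment> \<open>Keeps the coefficient \<open>1 - u * r\<close> of \<open>ln (p n)\<close>
    nonnegative, so the upper bound on \<open>ln (p n)\<close> may be inserted.\<close>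
  have ur: "u * r \<le> 1" using u r mult_mono[of u 1 r 1] by simp
  show ?thesis
  proof (rule mBIC_consistent_const[OF D_small \<tau>(2,3), of "u * s - (1 - u * r) * \<delta>" "(1 - u * r) * ln B"])
    show "\<forall>\<^sub>F n in sequentially. ln (p n) - (1 - \<tau>)\<^sup>2 * (\<sigma>\<^sup>2 / (2 * b\<^sup>2)) * penalty n
        \<le> (1 - u * r) * ln B - (u * s - (1 - u * r) * \<delta>) * ln n"
      using lnp
    proof eventually_elim
      case (elim n)
      have "ln (p n) - u * s * penalty n = (1 - u * r) * ln (p n) - u * s * ln n"
        by (simp add: penalty_def r_def algebra_simps)
      also have "\<dots> \<le> (1 - u * r) * (ln B + \<delta> * ln n) - u * s * ln n"
        using ur elim by (intro diff_right_mono mult_left_mono) auto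
      also have "\<dots> = (1 - u * r) * ln B - (u * s - (1 - u * r) * \<delta>) * ln n"
        by (simp add: algebra_simps)
      finally show ?case by (simp add: u_def s_def)
    qed
  qed (use \<tau> in \<open>simp add: u_def\<close>)
qed

text \<open>The multiples of \<open>ln (p n)\<close> cancel up to the loss
  \<open>1 - \<theta> n\<close>. With these \<eta> and \<open>L\<close>, the loss and the price
  \<open>ln (L n) / 2\<close> are both \<open>o(ln n)\<close>, so the \<open>ln n\<close> part of
  the penalty wins.\<close>

lemma mBIC_consistent_critical_gamma:
  assumes g: "\<gamma> = b\<^sup>2 / \<sigma>\<^sup>2" and lnp: "(\<lambda>n. sqrt (ln (real (p n)))) \<in> o(\<lambda>n. ln (real n))"
    and \<alpha>: "\<alpha> < 1" "(\<lambda>n. real (p\<^sub>0 n)) \<in> O(\<lambda>n. real n powr \<alpha>)"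
  shows "mBIC_consistent \<gamma> k p x \<beta> M \<epsilon>"
proof -
  obtain a where a: "a > 0" "\<forall>\<^sub>F n in sequentially. norm (real (p\<^sub>0 n)) \<le> a * norm (real n powr \<alpha>)"
    using landau_o.bigE[OF \<alpha>(2)] by blast
  define l where "l n = ln (real (p n))" for n
  define w where "w n = sqrt (l n) / ln (real n)" for n
  define \<eta> where "\<eta> n = 1 / ln (real n)" for n :: nat
  define L where "L n = 1 + sqrt (l n)" for n
  define \<theta> where "\<theta> n = (1 - 1 / L n) * (1 - 2 * \<eta> n)" for n
  define s where "s = \<sigma>\<^sup>2 / (2 * b\<^sup>2)"
  have s: "s > 0" using b_pos sigma by (simp add: s_def)
  have s\<gamma>: "2 * \<gamma> * s = 1" using g b_pos sigma by (simp add: s_def)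
  have w: "w \<longlonglongrightarrow> 0" using smalloD_tendsto[OF lnp] by (simp add: w_def[abs_def] l_def)
  have \<eta>: "\<eta> \<longlonglongrightarrow> 0" unfolding \<eta>_def by real_asymp
  have L: "filterlim L at_top sequentially"
    unfolding L_def l_def
    by (intro filterlim_tendsto_add_at_top[OF tendsto_const] filterlim_compose[OF sqrt_at_top ln_p_at_top])
  have "(\<lambda>n. 1 / L n) \<longlonglongrightarrow> 0"
    by (intro tendsto_divide_0[OF tendsto_const] filterlim_at_top_imp_at_infinity L)
  hence "\<theta> \<longlonglongrightarrow> (1 - 0) * (1 - 2 * 0)" unfolding \<theta>_def using \<eta> by (intro tendsto_intros)
  hence "(\<lambda>n. w n + 2 * (w n)\<^sup>2 + w n / 2 - \<theta> n * s) \<longlonglongrightarrow> 0 + 2 * 0\<^sup>2 + 0 / 2 - 1 * s"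
    using w by (intro tendsto_intros) auto
  \<comment> \<open>The whole exponent will be bounded by this expression times \<open>ln n\<close>;
    its limit is \<open>- s\<close>, and half of that is kept.\<close>
  hence bracket: "\<forall>\<^sub>F n in sequentially. w n + 2 * (w n)\<^sup>2 + w n / 2 - \<theta> n * s < - (s / 2)"
    by (rule order_tendstoD(2)) (use s in simp)
  have w_less: "\<forall>\<^sub>F n in sequentially. w n < 1" by (rule order_tendstoD(2)[OF w]) simp
  have eta_half: "\<forall>\<^sub>F n in sequentially. \<eta> n < 1 / 2" by (rule order_tendstoD(2)[OF \<eta>]) simp
  have ev: "\<forall>\<^sub>F n in sequentially. 0 < \<eta> n \<and> \<eta> n < 1 / 2 \<and> L n > 1"
    using eta_half eventually_ge_at_top[of 2]
  proof eventually_elim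
    case (elim n)
    hence "l n > 0" using p_ge[of n] by (simp add: l_def)
    thus ?case using elim by (simp add: \<eta>_def L_def)
  qed
  show ?thesis
  proof (rule mBIC_consistentI[OF ev])
    show "(\<lambda>n. D n / (n * \<eta> n)) \<longlonglongrightarrow> 0"
    proof (rule tendsto_sandwich[OF _ _ tendsto_const])
      show "\<forall>\<^sub>F n in sequentially. 0 \<le> D n / (n * \<eta> n)"
        using ev eventually_ge_at_top[of 1]
      proof eventually_elim
        case (elim n)
        have "0 \<le> ln (real (p n))" using elim p_ge[of n] by simp
        thus ?case using elim by simp
      qed
      \<comment> \<open>Eventually \<open>w n < 1\<close>, that is, \<open>ln (p n)\<close> is at
        most the square of \<open>ln n\<close>; only a logarithmic factor is added to
        \<open>n powr (\<alpha> - 1)\<close>.\<close>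
      show "\<forall>\<^sub>F n in sequentially. D n / (n * \<eta> n) \<le> a * n powr \<alpha> * (ln n)\<^sup>2 / (n * (1 / ln n))"
        using a(2) w_less eventually_ge_at_top[of 2]
      proof eventually_elim
        case (elim n)
        have l: "l n \<ge> 0" using elim(3) p_ge[of n] by (simp add: l_def)
        have lnn: "ln (real n) > 0" using elim(3) by simp
        have "sqrt (l n) \<le> ln n" using elim(2) lnn by (simp add: w_def pos_divide_less_eq)
        hence "(sqrt (l n))\<^sup>2 \<le> (ln n)\<^sup>2" using l by (intro power_mono) auto
        hence "l n \<le> (ln n)\<^sup>2" using l by simp
        moreover have "real (p\<^sub>0 n) \<le> a * n powr \<alpha>" using elim(1) by simp
        ultimately have "real (p\<^sub>0 n) * l n \<le> a * n powr \<alpha> * (ln n)\<^sup>2"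
          using l a(1) by (intro mult_mono) auto
        thus ?case using lnn unfolding \<eta>_def l_def by (intro divide_right_mono) auto
      qed
      show "(\<lambda>n. a * real n powr \<alpha> * (ln (real n))\<^sup>2 / (real n * (1 / ln (real n)))) \<longlonglongrightarrow> 0"
        using \<alpha>(1) by real_asymp
    qed
    show "filterlim (\<lambda>n. real n * (\<eta> n)\<^sup>2) at_top sequentially" unfolding \<eta>_def by real_asymp
    show "(\<lambda>n. overfit_rate (\<eta> n) (L n) n * p n) \<longlonglongrightarrow> 0"
    proof (rule overfit_rate_tendsto_0[of "s / 2" _ _ 0])
      show "\<forall>\<^sub>F n in sequentially. L n > 1 \<and>
         ln (p n) - (1 - 1 / L n) * (1 - 2 * \<eta> n) * (\<sigma>\<^sup>2 / (2 * b\<^sup>2)) * penalty n + ln (L n) / 2 \<le> 0 - s / 2 * ln n"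
        using ev bracket eventually_ge_at_top[of 2]
      proof eventually_elim
        case (elim n)
        have l: "l n > 0" using elim(3) p_ge[of n] by (simp add: l_def)
        have lnn: "ln (real n) > 0" using elim(3) by simp
        have wl1: "w n * ln n = sqrt (l n)" using lnn by (simp add: w_def)
        have "(w n)\<^sup>2 * ln n = w n * (w n * ln n)" by (simp add: power2_eq_square)
        also have "\<dots> = l n * \<eta> n" unfolding wl1 using l by (simp add: w_def \<eta>_def)
        finally have wl2: "(w n)\<^sup>2 * ln n = l n * \<eta> n" .
        have "1 - \<theta> n = 1 / L n + 2 * \<eta> n - 1 / L n * (2 * \<eta> n)" by (simp add: \<theta>_def algebra_simps)
        also have "\<dots> \<le> 1 / L n + 2 * \<eta> n" using elim(1) by simp
        finally have "(1 - \<theta> n) * l n \<le> (1 / L n + 2 * \<eta> n) * l n" using l by (intro mult_right_mono) auto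
        also have "\<dots> = 1 / L n * l n + 2 * (l n * \<eta> n)" by (simp add: distrib_right)
        \<comment> \<open>The choice \<open>L n = 1 + sqrt (l n)\<close> balances the two costs of
          \<open>L\<close>: both \<open>l n / L n\<close> and \<open>ln (L n)\<close> are at most
          \<open>sqrt (l n)\<close>.\<close>
        also have "1 / L n * l n \<le> sqrt (l n)"
        proof -
          have "l n = sqrt (l n) * sqrt (l n)" using l by simp
          also have "\<dots> \<le> sqrt (l n) * L n" using l by (intro mult_left_mono) (auto simp: L_def)
          finally show ?thesis using elim(1) by (simp add: pos_divide_le_eq)
        qed
        finally have 1: "(1 - \<theta> n) * l n \<le> sqrt (l n) + 2 * (l n * \<eta> n)" by simp
        have 2: "ln (L n) \<le> sqrt (l n)" unfolding L_def using l by (intro ln_add_one_self_le_self) auto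
        have "\<theta> n * s * penalty n = \<theta> n * s * ln n + \<theta> n * (2 * \<gamma> * s) * l n"
          by (simp add: penalty_def l_def algebra_simps)
        hence "l n - \<theta> n * s * penalty n + ln (L n) / 2 = (1 - \<theta> n) * l n - \<theta> n * s * ln n + ln (L n) / 2"
          unfolding s\<gamma> by (simp add: algebra_simps)
        also have "\<dots> \<le> sqrt (l n) + 2 * (l n * \<eta> n) - \<theta> n * s * ln n + sqrt (l n) / 2"
          using 1 2 by linarith
        \<comment> \<open>All terms become multiples of \<open>ln n\<close>, since
          \<open>sqrt (l n)\<close> is \<open>w n * ln n\<close> and \<open>l n * \<eta> n\<close>
          is \<open>(w n)\<^sup>2 * ln n\<close>.\<close>
        also have "\<dots> = (w n + 2 * (w n)\<^sup>2 + w n / 2 - \<theta> n * s) * ln n"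
          unfolding wl1[symmetric] wl2[symmetric] by (simp add: algebra_simps)
        also have "\<dots> \<le> - (s / 2) * ln n" using elim(2) lnn by (intro mult_right_mono) auto
        finally show ?case using elim(1) by (simp add: \<theta>_def s_def l_def)
      qed
    qed (use s in simp)
  qed
qed

end

section \<open>The three cases together\<close>

theorem theorem5:
  fixes p p\<^sub>0 :: "nat \<Rightarrow> nat"
    and x :: "nat \<Rightarrow> nat \<Rightarrow> nat \<Rightarrow> real"
    and \<beta> :: "nat \<Rightarrow> nat \<Rightarrow> real"
    and M :: "nat \<Rightarrow> 'a measure"
    and \<epsilon> :: "nat \<Rightarrow> nat \<Rightarrow> 'a \<Rightarrow> real"
    and D :: "real measure"
    and b \<sigma> \<gamma> k :: real
  assumes prob: "\<And>n. n \<ge> 1 \<Longrightarrow> prob_space (M n)"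
    and indep: "\<And>n. n \<ge> 1 \<Longrightarrow> prob_space.indep_vars (M n) (\<lambda>_. borel) (\<epsilon> n) {1..n}"
    and ident: "\<And>n i. 1 \<le> i \<Longrightarrow> i \<le> n \<Longrightarrow> distr (M n) borel (\<epsilon> n i) = D"
    and subg: "\<And>n i. 1 \<le> i \<Longrightarrow> i \<le> n \<Longrightarrow> subgaussian b (M n) (\<epsilon> n i)"
    and var: "\<And>n i. 1 \<le> i \<Longrightarrow> i \<le> n \<Longrightarrow> prob_space.variance (M n) (\<epsilon> n i) = \<sigma>\<^sup>2"
    and sigma: "\<sigma> > 0"
    and p_ge: "\<And>n. n \<ge> 1 \<Longrightarrow> p n \<ge> n"
    and p0_def: "\<And>n. p\<^sub>0 n = card (true_model (p n) (\<beta> n))"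
    and p0_ge: "\<And>n. n \<ge> 1 \<Longrightarrow> p\<^sub>0 n \<ge> 1"
    and k: "k > 1"
    and cond: "consistency_condition k p x \<beta>"
    and gamma: "\<gamma> \<ge> 1"
  shows
    "((\<lambda>n. real (p\<^sub>0 n) * ln (real (p n))) \<in> o(\<lambda>n. real n) \<and> \<gamma> > b\<^sup>2 / \<sigma>\<^sup>2
        \<longrightarrow> mBIC_consistent \<gamma> k p x \<beta> M \<epsilon>)
     \<and>
     (\<gamma> = b\<^sup>2 / \<sigma>\<^sup>2 \<and>
        (\<lambda>n. sqrt (ln (real (p n)))) \<in> o(\<lambda>n. ln (real n)) \<and>
        (\<exists>\<alpha><1. (\<lambda>n. real (p\<^sub>0 n)) \<in> O(\<lambda>n. real n powr \<alpha>))
        \<longrightarrow> mBIC_consistent \<gamma> k p x \<beta> M \<epsilon>)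
     \<and>
     (\<gamma> < b\<^sup>2 / \<sigma>\<^sup>2 \<and>
        (\<exists>\<alpha><1. (\<lambda>n. real (p\<^sub>0 n)) \<in> O(\<lambda>n. real n powr \<alpha>)) \<and>
        (\<exists>\<delta> < 1 / (2 * (b\<^sup>2 / \<sigma>\<^sup>2 - \<gamma>)). (\<lambda>n. real (p n)) \<in> O(\<lambda>n. real n powr \<delta>))
        \<longrightarrow> mBIC_consistent \<gamma> k p x \<beta> M \<epsilon>)"
proof -
  interpret sparse_regression p p\<^sub>0 x \<beta> M \<epsilon> b \<sigma> \<gamma> k
  proof (rule sparse_regression.intro)
    show "\<gamma> \<ge> 0" using gamma by simp
  qed (fact prob indep subg var sigma p_ge p0_def p0_ge k cond)+
  show ?thesis
  proof (intro conjI impI; elim conjE exE)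
    assume "(\<lambda>n. real (p\<^sub>0 n) * ln (real (p n))) \<in> o(\<lambda>n. real n)" "\<gamma> > b\<^sup>2 / \<sigma>\<^sup>2"
    thus "mBIC_consistent \<gamma> k p x \<beta> M \<epsilon>" by (rule mBIC_consistent_large_gamma)
  qed (rule mBIC_consistent_critical_gamma mBIC_consistent_small_gamma; assumption)+
qed

end
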